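(* Let $q\in\mathbb{C}^*$ be generic. The set of simple objects (up to isomorphism) of the category $\mathcal{C}$ of admissible $\mathcal{A}_q(2)$-modules is $$\left\{L_{(a,b)}[\lambda]\mid(a,b)\in\mathcal{P}_{red},\ [\lambda]\in\mathbb{C}^*/q^{\mathbb{Z}}\right\}.$$
   Context: Generic means that $q$ is not a root of unity; $\mathbb{Z}_+$ denotes the non-negative integers; $q^{\mathbb{Z}}=\{q^m\mid m\in\mathbb{Z}\}$. $\mathcal{A}_q(2)$ is the associative unital $\mathbb{C}$-algebra generated by $x,y$ with relation $xy=q\,yx$. Modules are left modules. For $(m,n)\in\mathbb{Z}_+^2\setminus\{(0,0)\}$ and $D=x^my^n$, a module $M$ is locally $D$-finite if $\mathbb{C}[D]w$ is finite dimensional for every $w\in M$; $\widetilde{\mathcal{C}}_{(m,n)}$ is the category of locally $D$-finite $\mathcal{A}_q(2)$-modules. Let $\widetilde{\mathcal{A}}^{(1,1)}_q$ be the localisation of $\mathcal{A}_q(2)$ at the powers of $xy$. For an $\mathcal{A}_q(2)$-module $M$ let $\kappa^{(1,1)}:M\to\widetilde{\mathcal{A}}^{(1,1)}_q\otimes_{\mathcal{A}_q(2)}M$, $v\mapsto1\otimes v$. $M$ is admissible if there are finitely many submodules $M_j$ with $M=\sum_jM_j$ such that (i) each $M_j\in\widetilde{\mathcal{C}}_{(m_j,n_j)}$ for some $(m_j,n_j)\in\mathbb{Z}_+^2\setminus\{(0,0)\}$, and (ii) $\kappa^{(1,1)}$ is injective. $\mathcal{C}$ is the category of admissible modules; its simple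 objects are the objects that are simple as $\mathcal{A}_q(2)$-modules. $\mathcal{P}_{red}$ is the set of pairs $(a,b)$ of co-prime positive integers. For $(a,b)\in\mathcal{P}_{red}$ and $[\lambda]\in\mathbb{C}^*/q^{\mathbb{Z}}$, $L_{(a,b)}[\lambda]$ denotes the simple $\mathcal{A}_q(2)$-module cyclically generated by an eigenvector of $K=x^ay^b$ with eigenvalue $\lambda$ (it exists, is unique up to isomorphism, and depends only on the class $[\lambda]$). *)

theory Defs
  imports Complex_Main "HOL-Algebra.Algebra" "HOL-Library.Poly_Mapping"
begin

section \<open>Left modules over a non-commutative ring\<close>

text \<open>The locale \<open>module\<close> of HOL-Algebra requires a commutative ring of scalars; only its
  record type and the locale \<open>submodule\<close> are reused here. The fields \<open>mult\<close> and \<open>one\<close>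
  of the record are irrelevant for modules.\<close>

locale left_module = R?: ring R + M?: abelian_group M
  for R :: "'r ring" (structure) and M :: "('r, 'v) module" (structure) +
  assumes smult_closed:
      "\<lbrakk> a \<in> carrier R; v \<in> carrier M \<rbrakk> \<Longrightarrow> a \<odot>\<^bsub>M\<^esub> v \<in> carrier M"
    and smult_l_distr:
      "\<lbrakk> a \<in> carrier R; b \<in> carrier R; v \<in> carrier M \<rbrakk> \<Longrightarrow>
        (a \<oplus>\<^bsub>R\<^esub> b) \<odot>\<^bsub>M\<^esub> v = a \<odot>\<^bsub>M\<^esub> v \<oplus>\<^bsub>M\<^esub> b \<odot>\<^bsub>M\<^esub> v"
    and smult_r_distr:
      "\<lbrakk> a \<in> carrier R; v \<in> carrier M; w \<in> carrier M \<rbrakk> \<Longrightarrow>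
        a \<odot>\<^bsub>M\<^esub> (v \<oplus>\<^bsub>M\<^esub> w) = a \<odot>\<^bsub>M\<^esub> v \<oplus>\<^bsub>M\<^esub> a \<odot>\<^bsub>M\<^esub> w"
    and smult_assoc:
      "\<lbrakk> a \<in> carrier R; b \<in> carrier R; v \<in> carrier M \<rbrakk> \<Longrightarrow>
        (a \<otimes>\<^bsub>R\<^esub> b) \<odot>\<^bsub>M\<^esub> v = a \<odot>\<^bsub>M\<^esub> (b \<odot>\<^bsub>M\<^esub> v)"
    and smult_one:
      "v \<in> carrier M \<Longrightarrow> \<one>\<^bsub>R\<^esub> \<odot>\<^bsub>M\<^esub> v = v"

definition simple_module :: "'r ring \<Rightarrow> ('r, 'v) module \<Rightarrow> bool" where
  "simple_module R M \<longleftrightarrow>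
     left_module R M \<and> carrier M \<noteq> {\<zero>\<^bsub>M\<^esub>} \<and>
     (\<forall>N. submodule N R M \<longrightarrow> N = {\<zero>\<^bsub>M\<^esub>} \<or> N = carrier M)"

definition isomorphic_modules :: "'r ring \<Rightarrow> ('r, 'v) module \<Rightarrow> ('r, 'v) module \<Rightarrow> bool" where
  "isomorphic_modules R M N \<longleftrightarrow>
     (\<exists>f. bij_betw f (carrier M) (carrier N) \<and>
       (\<forall>v\<in>carrier M. \<forall>w\<in>carrier M. f (v \<oplus>\<^bsub>M\<^esub> w) = f v \<oplus>\<^bsub>N\<^esub> f w) \<and>
       (\<forall>r\<in>carrier R. \<forall>v\<in>carrier M. f (r \<odot>\<^bsub>M\<^esub> v) = r \<odot>\<^bsub>N\<^esub> f v))"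

text \<open>Isomorphism class of \<open>M\<close> among all modules whose carrier is a subset of \<open>'v\<close>;
  \<open>'v\<close> must be large enough to contain a copy of every module of interest.\<close>

definition iso_class :: "'r ring \<Rightarrow> ('r, 'v) module \<Rightarrow> ('r, 'v) module set" where
  "iso_class R M = {N. left_module R N \<and> isomorphic_modules R M N}"

definition finite_sum_of :: "('r, 'v) module \<Rightarrow> nat \<Rightarrow> (nat \<Rightarrow> 'v set) \<Rightarrow> 'v set" where
  "finite_sum_of M k N = {finsum M u {..<k} | u. \<forall>j<k. u j \<in> N j}"


section \<open>Extension of scalars\<close>

text \<open>For a ring homomorphism \<open>\<iota>\<close> from \<open>R\<close> to \<open>B\<close> (making \<open>B\<close> a right \<open>R\<close>-module) and
  a left \<open>R\<close>-module \<open>M\<close>, the abelian group underlying the tensor product of \<open>B\<close> and \<open>M\<close>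
  over \<open>R\<close>: the free abelian group on pairs, modulo biadditivity and \<open>R\<close>-balancedness.\<close>

definition tensor_relators ::
    "'r ring \<Rightarrow> 'b ring \<Rightarrow> ('r \<Rightarrow> 'b) \<Rightarrow> ('r, 'v) module \<Rightarrow> (('b \<times> 'v) \<Rightarrow>\<^sub>0 int) set" where
  "tensor_relators R B \<iota> M =
     {frag_of (b \<oplus>\<^bsub>B\<^esub> b', v) - frag_of (b, v) - frag_of (b', v) | b b' v.
        b \<in> carrier B \<and> b' \<in> carrier B \<and> v \<in> carrier M} \<union>
     {frag_of (b, v \<oplus>\<^bsub>M\<^esub> v') - frag_of (b, v) - frag_of (b, v') | b v v'.
        b \<in> carrier B \<and> v \<in> carrier M \<and> v' \<in> carrier M} \<union>
     {frag_of (b \<otimes>\<^bsub>B\<^esub> \<iota> r, v) - frag_of (b, r \<odot>\<^bsub>M\<^esub> v) | b r v.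
        b \<in> carrier B \<and> r \<in> carrier R \<and> v \<in> carrier M}"

definition tensor_kernel ::
    "'r ring \<Rightarrow> 'b ring \<Rightarrow> ('r \<Rightarrow> 'b) \<Rightarrow> ('r, 'v) module \<Rightarrow> (('b \<times> 'v) \<Rightarrow>\<^sub>0 int) set" where
  "tensor_kernel R B \<iota> M =
     generate (free_Abelian_group (carrier B \<times> carrier M)) (tensor_relators R B \<iota> M)"

definition tensor_group ::
    "'r ring \<Rightarrow> 'b ring \<Rightarrow> ('r \<Rightarrow> 'b) \<Rightarrow> ('r, 'v) module \<Rightarrow> (('b \<times> 'v) \<Rightarrow>\<^sub>0 int) set monoid" where
  "tensor_group R B \<iota> M =
     free_Abelian_group (carrier B \<times> carrier M) Mod tensor_kernel R B \<iota> M"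

definition pure_tensor ::
    "'r ring \<Rightarrow> 'b ring \<Rightarrow> ('r \<Rightarrow> 'b) \<Rightarrow> ('r, 'v) module \<Rightarrow> 'b \<Rightarrow> 'v \<Rightarrow> (('b \<times> 'v) \<Rightarrow>\<^sub>0 int) set" where
  "pure_tensor R B \<iota> M b v =
     tensor_kernel R B \<iota> M #>\<^bsub>free_Abelian_group (carrier B \<times> carrier M)\<^esub> frag_of (b, v)"


section \<open>Free algebras\<close>

text \<open>The free complex algebra on a set of letters is the monoid algebra of the free monoid.
  Words are given an additive monoid structure because multiplication of \<open>\<Rightarrow>\<^sub>0\<close>
  is convolution over \<open>+\<close>.\<close>

datatype 'g word = Word (letters: "'g list")

instantiation word :: (type) monoid_add
begin
definition zero_word :: "'a word" where "zero_word = Word []"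
definition plus_word :: "'a word \<Rightarrow> 'a word \<Rightarrow> 'a word" where
  "plus_word u v = Word (letters u @ letters v)"
instance by standard (simp_all add: zero_word_def plus_word_def)
end

definition free_algebra :: "'g set \<Rightarrow> ('g word \<Rightarrow>\<^sub>0 complex) ring" where
  "free_algebra S =
     \<lparr>carrier = {p. \<forall>w\<in>Poly_Mapping.keys p. set (letters w) \<subseteq> S},
      monoid.mult = (*), one = 1, ring.zero = 0, ring.add = (+)\<rparr>"

abbreviation monomial :: "'g list \<Rightarrow> 'g word \<Rightarrow>\<^sub>0 complex" where
  "monomial w \<equiv> Poly_Mapping.single (Word w) 1"

abbreviation const :: "complex \<Rightarrow> 'g word \<Rightarrow>\<^sub>0 complex" where
  "const c \<equiv> Poly_Mapping.single (Word []) c"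


section \<open>The quantum plane and its localisation\<close>

datatype letter = Lx | Ly | Linv

type_synonym free_elem = "letter word \<Rightarrow>\<^sub>0 complex"

definition plane_relator :: "complex \<Rightarrow> free_elem" where
  "plane_relator q = monomial [Lx, Ly] - const q * monomial [Ly, Lx]"

definition plane_ideal :: "complex \<Rightarrow> free_elem set" where
  "plane_ideal q = Idl\<^bsub>free_algebra {Lx, Ly}\<^esub> {plane_relator q}"

definition quantum_plane :: "complex \<Rightarrow> free_elem set ring" where
  "quantum_plane q = free_algebra {Lx, Ly} Quot plane_ideal q"

definition plane_class :: "complex \<Rightarrow> free_elem \<Rightarrow> free_elem set" where
  "plane_class q p = plane_ideal q +>\<^bsub>free_algebra {Lx, Ly}\<^esub> p"

abbreviation plane_x :: "complex \<Rightarrow> free_elem set" where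
  "plane_x q \<equiv> plane_class q (monomial [Lx])"

abbreviation plane_y :: "complex \<Rightarrow> free_elem set" where
  "plane_y q \<equiv> plane_class q (monomial [Ly])"

abbreviation plane_scalar :: "complex \<Rightarrow> complex \<Rightarrow> free_elem set" where
  "plane_scalar q c \<equiv> plane_class q (const c)"

definition plane_monomial :: "complex \<Rightarrow> nat \<Rightarrow> nat \<Rightarrow> free_elem set" where
  "plane_monomial q m n =
     (plane_x q [^]\<^bsub>quantum_plane q\<^esub> m) \<otimes>\<^bsub>quantum_plane q\<^esub> (plane_y q [^]\<^bsub>quantum_plane q\<^esub> n)"

text \<open>Localisation at the powers of \<open>xy\<close>: inverting them all amounts to adjoining a
  two-sided inverse of \<open>xy\<close>, namely the letter \<open>Linv\<close>.\<close>

definition loc_ideal :: "complex \<Rightarrow> free_elem set" where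
  "loc_ideal q = Idl\<^bsub>free_algebra {Lx, Ly, Linv}\<^esub>
     {plane_relator q, monomial [Linv, Lx, Ly] - 1, monomial [Lx, Ly, Linv] - 1}"

definition localised_plane :: "complex \<Rightarrow> free_elem set ring" where
  "localised_plane q = free_algebra {Lx, Ly, Linv} Quot loc_ideal q"

text \<open>The canonical map sends the class \<open>plane_ideal q + p\<close> to \<open>loc_ideal q + p\<close>; as
  \<open>plane_ideal q \<subseteq> loc_ideal q\<close>, the latter is obtained by adding \<open>loc_ideal q\<close> to the
  former elementwise.\<close>

definition loc_map :: "complex \<Rightarrow> free_elem set \<Rightarrow> free_elem set" where
  "loc_map q C = loc_ideal q <+>\<^bsub>free_algebra {Lx, Ly, Linv}\<^esub> C"

definition kappa ::
    "complex \<Rightarrow> (free_elem set, 'v) module \<Rightarrow> 'v \<Rightarrow> ((free_elem set \<times> 'v) \<Rightarrow>\<^sub>0 int) set" where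
  "kappa q M v =
     pure_tensor (quantum_plane q) (localised_plane q) (loc_map q) M \<one>\<^bsub>localised_plane q\<^esub> v"


section \<open>Locally finite and admissible modules\<close>

definition complex_subspace :: "complex \<Rightarrow> (free_elem set, 'v) module \<Rightarrow> 'v set \<Rightarrow> bool" where
  "complex_subspace q M W \<longleftrightarrow>
     subgroup W (add_monoid M) \<and> (\<forall>c. \<forall>w\<in>W. plane_scalar q c \<odot>\<^bsub>M\<^esub> w \<in> W)"

definition complex_span :: "complex \<Rightarrow> (free_elem set, 'v) module \<Rightarrow> 'v set \<Rightarrow> 'v set" where
  "complex_span q M F = \<Inter>{W. complex_subspace q M W \<and> F \<subseteq> W}"

definition finite_dimensional :: "complex \<Rightarrow> (free_elem set, 'v) module \<Rightarrow> 'v set \<Rightarrow> bool" where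
  "finite_dimensional q M W \<longleftrightarrow> (\<exists>F. finite F \<and> F \<subseteq> W \<and> W = complex_span q M F)"

definition polynomials_in :: "complex \<Rightarrow> free_elem set \<Rightarrow> free_elem set set" where
  "polynomials_in q D =
     {finsum (quantum_plane q)
        (\<lambda>i. plane_scalar q (c i) \<otimes>\<^bsub>quantum_plane q\<^esub> (D [^]\<^bsub>quantum_plane q\<^esub> i)) {..d} |
      (c :: nat \<Rightarrow> complex) (d :: nat). True}"

definition locally_finite_cat :: "complex \<Rightarrow> nat \<Rightarrow> nat \<Rightarrow> (free_elem set, 'v) module set" where
  "locally_finite_cat q m n =
     {M. left_module (quantum_plane q) M \<and>
         (\<forall>w\<in>carrier M. finite_dimensional q M
            {r \<odot>\<^bsub>M\<^esub> w | r. r \<in> polynomials_in q (plane_monomial q m n)})}"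

definition admissible :: "complex \<Rightarrow> (free_elem set, 'v) module \<Rightarrow> bool" where
  "admissible q M \<longleftrightarrow>
     left_module (quantum_plane q) M \<and>
     (\<exists>k N. (\<forall>j<k. submodule (N j) (quantum_plane q) M) \<and>
        carrier M = finite_sum_of M k N \<and>
        (\<forall>j<k. \<exists>m n. (m, n) \<noteq> (0, 0) \<and> M\<lparr>carrier := N j\<rparr> \<in> locally_finite_cat q m n)) \<and>
     inj_on (kappa q M) (carrier M)"

definition simple_admissible :: "complex \<Rightarrow> (free_elem set, 'v) module \<Rightarrow> bool" where
  "simple_admissible q M \<longleftrightarrow> admissible q M \<and> simple_module (quantum_plane q) M"


section \<open>The modules L\<close>

definition generic :: "complex \<Rightarrow> bool" where
  "generic q \<longleftrightarrow> (\<forall>n::nat. 0 < n \<longrightarrow> q ^ n \<noteq> 1)"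

definition P_red :: "(nat \<times> nat) set" where
  "P_red = {(a, b). 0 < a \<and> 0 < b \<and> coprime a b}"

definition q_class :: "complex \<Rightarrow> complex \<Rightarrow> complex set" where
  "q_class q \<mu> = range (\<lambda>m. \<mu> * q powi m)"

definition Cstar_mod_q :: "complex \<Rightarrow> complex set set" where
  "Cstar_mod_q q = q_class q ` (- {0})"

text \<open>\<open>L q a b \<Lambda>\<close> collects the simple modules that are cyclically generated by
  an eigenvector of \<open>x^a y^b\<close> with eigenvalue in the class \<open>\<Lambda>\<close>, so it stands for the module
  considered up to isomorphism.\<close>

definition L :: "complex \<Rightarrow> nat \<Rightarrow> nat \<Rightarrow> complex set \<Rightarrow> (free_elem set, 'v) module set" where
  "L q a b \<Lambda> =
     {M. simple_module (quantum_plane q) M \<and>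
         (\<exists>\<mu>\<in>\<Lambda>. \<exists>v\<in>carrier M. v \<noteq> \<zero>\<^bsub>M\<^esub> \<and>
            plane_monomial q a b \<odot>\<^bsub>M\<^esub> v = plane_scalar q \<mu> \<odot>\<^bsub>M\<^esub> v \<and>
            carrier M = {r \<odot>\<^bsub>M\<^esub> v | r. r \<in> carrier (quantum_plane q)})}"

end

theory Submission
  imports Defs "HOL-Computational_Algebra.Fundamental_Theorem_Algebra"
begin

text \<open>
  Write \<open>K = x^a y^b\<close> with \<open>a, b\<close> coprime. If \<open>K v = \<mu> v\<close> with \<open>\<mu> \<noteq> 0\<close>, then every word in \<open>x\<close> and
  \<open>y\<close> sends \<open>v\<close> to an eigenvector with eigenvalue \<open>\<mu> q^t\<close>, where the weight \<open>t\<close> depends on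
  the word only. As \<open>q\<close> is generic, these eigenvalues are distinct for distinct \<open>t\<close>, and words of weight
  \<open>0\<close> are scalar multiples of powers of \<open>K\<close>. So the weight zero component of \<open>p v\<close> is \<open>\<sigma> v\<close>
  with a scalar \<open>\<sigma>\<close> that depends on \<open>p\<close> and \<open>\<mu>\<close> but not on the module. Hence eigenvectors with
  eigenvalue \<open>\<mu>\<close> in two simple modules have the same annihilator, and the modules are isomorphic.

  A simple admissible module is locally finite for some \<open>x^m y^n\<close>, so it has an eigenvector of \<open>K\<close>
  for the primitive exponent \<open>(a, b)\<close>. Injectivity of \<open>kappa\<close> makes \<open>x\<close> and \<open>y\<close> injective, so that
  \<open>\<mu> \<noteq> 0\<close>. If \<open>a\<close> or \<open>b\<close> were \<open>0\<close>, the other generator would change the weight in one direction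
  only, and \<open>v\<close> would not lie in the submodule generated by its image.

  Conversely, functions of finite support on the integers, with \<open>x\<close> acting by a shift by \<open>b\<close>
  and \<open>y\<close> by a weighted shift by \<open>-a\<close>, form a simple module on which \<open>K\<close> is diagonal with
  eigenvalues \<open>\<mu> q^k\<close>. Since \<open>x\<close> and \<open>y\<close> are invertible there, the localised plane acts on it.
\<close>

subsection \<open>Free algebras and their quotients\<close>

abbreviation plane_words :: "free_elem set" where
  "plane_words \<equiv> carrier (free_algebra {Lx, Ly})"

lemma free_algebra_simps [simp]:
  "\<one>\<^bsub>free_algebra S\<^esub> = 1" "\<zero>\<^bsub>free_algebra S\<^esub> = 0"
  "p \<oplus>\<^bsub>free_algebra S\<^esub> p' = p + p'" "p \<otimes>\<^bsub>free_algebra S\<^esub> p' = p * p'"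
  by (simp_all add: free_algebra_def)

lemma carrier_free_algebra:
  "p \<in> carrier (free_algebra S) \<longleftrightarrow> (\<forall>w\<in>Poly_Mapping.keys p. set (letters w) \<subseteq> S)"
  by (simp add: free_algebra_def)

lemma letters_plus [simp]: "letters (u + v) = letters u @ letters v"
  by (simp add: plus_word_def)

lemma letters_zero [simp]: "letters 0 = []"
  by (simp add: zero_word_def)

lemma free_algebra_closed [simp, intro]:
  "0 \<in> carrier (free_algebra S)" "1 \<in> carrier (free_algebra S)"
  "const c \<in> carrier (free_algebra S)"
  "p \<in> carrier (free_algebra S) \<Longrightarrow> - p \<in> carrier (free_algebra S)"
  "\<lbrakk>p \<in> carrier (free_algebra S); p' \<in> carrier (free_algebra S)\<rbrakk> \<Longrightarrow> p + p' \<in> carrier (free_algebra S)"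
  "\<lbrakk>p \<in> carrier (free_algebra S); p' \<in> carrier (free_algebra S)\<rbrakk> \<Longrightarrow> p - p' \<in> carrier (free_algebra S)"
  "\<lbrakk>p \<in> carrier (free_algebra S); p' \<in> carrier (free_algebra S)\<rbrakk> \<Longrightarrow> p * p' \<in> carrier (free_algebra S)"
proof -
  show "p + p' \<in> carrier (free_algebra S)" 
    if "p \<in> carrier (free_algebra S)" "p' \<in> carrier (free_algebra S)"
    using that keys_add[of p p'] by (fastforce simp: carrier_free_algebra)
  show "p - p' \<in> carrier (free_algebra S)" 
    if "p \<in> carrier (free_algebra S)" "p' \<in> carrier (free_algebra S)"
    using that keys_diff[of p p'] by (fastforce simp: carrier_free_algebra)
  show "p * p' \<in> carrier (free_algebra S)" 
    if "p \<in> carrier (free_algebra S)" "p' \<in> carrier (free_algebra S)"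
    using that keys_mult[of p p'] by (fastforce simp: carrier_free_algebra)
qed (simp_all add: carrier_free_algebra)

lemma monomial_closed [simp]:
  "set w \<subseteq> S \<Longrightarrow> Poly_Mapping.single (Word w) c \<in> carrier (free_algebra S)"
  by (simp add: carrier_free_algebra)

lemma free_algebra_power_closed [simp, intro]:
  "p \<in> carrier (free_algebra S) \<Longrightarrow> p ^ n \<in> carrier (free_algebra S)"
  by (induction n) auto

lemma ring_free_algebra: "ring (free_algebra S)"
proof (rule ringI)
  show "abelian_group (free_algebra S)"
    by (rule abelian_groupI) (auto simp: algebra_simps intro!: bexI[of _ "- _"])
  show "Group.monoid (free_algebra S)"
    by (rule monoidI) (auto simp: algebra_simps)
qed (auto simp: algebra_simps)

lemma free_algebra_minus [simp]:
  assumes "p \<in> carrier (free_algebra S)" "p' \<in> carrier (free_algebra S)"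
  shows "p \<ominus>\<^bsub>free_algebra S\<^esub> p' = p - p'"
proof -
  interpret ring "free_algebra S" by (rule ring_free_algebra)
  have "\<ominus>\<^bsub>free_algebra S\<^esub> p' = - p'"
    by (rule minus_equality) (use assms in auto)
  then show ?thesis by (simp add: a_minus_def)
qed

lemma const_one: "const 1 = 1"
  by (simp flip: zero_word_def)

lemma const_zero: "const 0 = 0"
  by simp

lemma const_mult: "const c * const d = const (c * d)"
  by (simp add: mult_single plus_word_def)

lemma const_add: "const c + const d = const (c + d)"
  by (simp add: single_add)

text \<open>The support grows by exactly the new word, with no cancellation, so a hypothesis on all
  words of an element passes to the smaller element.\<close>

lemma sparse_induct [case_names zero add]:
  fixes p :: "'w \<Rightarrow>\<^sub>0 complex"
  assumes "Q 0"
    and "\<And>w c p. \<lbrakk>Poly_Mapping.keys (Poly_Mapping.single w c + p) = insert w (Poly_Mapping.keys p); Q p\<rbrakk>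
           \<Longrightarrow> Q (Poly_Mapping.single w c + p)"
  shows "Q p"
proof (induction p rule: update_induct)
  case (update p w b)
  have eq: "Poly_Mapping.update w b p = Poly_Mapping.single w b + p"
    using update.hyps by (intro poly_mapping_eqI)
      (auto simp: lookup_update lookup_add lookup_single when_def in_keys_iff)
  have "Poly_Mapping.keys (Poly_Mapping.update w b p) = insert w (Poly_Mapping.keys p)"
    using update.hyps by (auto simp: in_keys_iff lookup_update split: if_splits)
  then show ?case 
    using update assms(2)[of w b p] by (simp add: eq)
qed (use assms in auto)

lemma free_elem_induct [case_names zero single add]:
  fixes p :: "'w \<Rightarrow>\<^sub>0 complex"
  assumes "Q 0"
    and "\<And>w c. Q (Poly_Mapping.single w c)"
    and "\<And>p p'. \<lbrakk>Q p; Q p'\<rbrakk> \<Longrightarrow> Q (p + p')"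
  shows "Q p"
  by (induction p rule: sparse_induct) (use assms in auto)

lemma const_commute: "const c * p = p * const c"
  by (induction p rule: free_elem_induct) (simp_all add: algebra_simps mult_single plus_word_def)

lemma monomial_mult: 
  "Poly_Mapping.single (Word u) c * Poly_Mapping.single (Word v) d
    = Poly_Mapping.single (Word (u @ v)) (c * d)"
  by (simp add: mult_single plus_word_def)

section \<open>The defining ideals and the two quotient rings\<close>

lemma ideal_plane_ideal: "ideal (plane_ideal q) (free_algebra {Lx, Ly})"
  unfolding plane_ideal_def
  by (rule ring.genideal_ideal[OF ring_free_algebra]) (auto simp: plane_relator_def)

lemma ideal_loc_ideal: "ideal (loc_ideal q) (free_algebra {Lx, Ly, Linv})"
  unfolding loc_ideal_def
  by (rule ring.genideal_ideal[OF ring_free_algebra]) (auto simp: plane_relator_def)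

definition loc_class :: "complex \<Rightarrow> free_elem \<Rightarrow> free_elem set" where
  "loc_class q p = loc_ideal q +>\<^bsub>free_algebra {Lx, Ly, Linv}\<^esub> p"

lemma carrier_quotient:
  "carrier (R Quot I) = (\<lambda>p. I +>\<^bsub>R\<^esub> p) ` carrier R"
  by (auto simp: FactRing_def A_RCOSETS_defs a_r_coset_def)

context
  fixes q :: complex
begin

interpretation J: ideal "plane_ideal q" "free_algebra {Lx, Ly}"
  by (rule ideal_plane_ideal)

interpretation hom: ring_hom_ring "free_algebra {Lx, Ly}" "quantum_plane q" "plane_class q"
  using J.rcos_ring_hom_ring unfolding quantum_plane_def plane_class_def .

lemma ring_quantum_plane: "ring (quantum_plane q)"
  by (rule hom.S.ring_axioms)

lemma carrier_quantum_plane: "carrier (quantum_plane q) = plane_class q ` plane_words"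
  by (simp add: quantum_plane_def plane_class_def[abs_def] carrier_quotient)

lemma plane_class_closed [simp]: "p \<in> plane_words \<Longrightarrow> plane_class q p \<in> carrier (quantum_plane q)"
  by (simp add: carrier_quantum_plane)

lemma plane_class_add:
  "\<lbrakk>p \<in> plane_words; p' \<in> plane_words\<rbrakk> \<Longrightarrow>
     plane_class q p \<oplus>\<^bsub>quantum_plane q\<^esub> plane_class q p' = plane_class q (p + p')"
  using hom.hom_add by simp

lemma plane_class_mult:
  "\<lbrakk>p \<in> plane_words; p' \<in> plane_words\<rbrakk> \<Longrightarrow>
     plane_class q p \<otimes>\<^bsub>quantum_plane q\<^esub> plane_class q p' = plane_class q (p * p')"
  using hom.hom_mult by simp

lemma plane_class_one: "\<one>\<^bsub>quantum_plane q\<^esub> = plane_class q 1"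
  using hom.hom_one by simp

lemma plane_class_pow:
  assumes "p \<in> plane_words"
  shows "plane_class q p [^]\<^bsub>quantum_plane q\<^esub> (n::nat) = plane_class q (p ^ n)"
proof -
  interpret ring "quantum_plane q" by (rule ring_quantum_plane)
  show ?thesis
    by (induction n) (use assms in \<open>auto simp: plane_class_one plane_class_mult power_commutes\<close>)
qed

lemma plane_class_eq_iff:
  "\<lbrakk>p \<in> plane_words; p' \<in> plane_words\<rbrakk> \<Longrightarrow>
     plane_class q p = plane_class q p' \<longleftrightarrow> p - p' \<in> plane_ideal q"
  using J.quotient_eq_iff_same_a_r_cos[OF ideal_plane_ideal, of p p'] by (simp add: plane_class_def)

lemma mem_plane_classE:
  assumes "r \<in> plane_class q p" "p \<in> plane_words"
  shows "r \<in> plane_words" "r - p \<in> plane_ideal q"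
  using assms J.a_subset
  by (auto simp: plane_class_def a_r_coset_def')

lemma self_mem_plane_class: "p \<in> plane_words \<Longrightarrow> p \<in> plane_class q p"
  using J.a_rcos_self by (simp add: plane_class_def)

lemma plane_class_xy: "plane_class q (monomial [Lx, Ly]) = plane_class q (const q * monomial [Ly, Lx])"
proof -
  have "plane_relator q \<in> plane_ideal q"
    unfolding plane_ideal_def
    by (intro J.genideal_self') (auto simp: plane_relator_def)
  then show ?thesis
    by (subst plane_class_eq_iff) (auto simp: plane_relator_def)
qed

interpretation I: ideal "loc_ideal q" "free_algebra {Lx, Ly, Linv}"
  by (rule ideal_loc_ideal)

interpretation lhom: ring_hom_ring "free_algebra {Lx, Ly, Linv}" "localised_plane q" "loc_class q"
  using I.rcos_ring_hom_ring unfolding localised_plane_def loc_class_def .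

lemma carrier_localised_plane: 
  "carrier (localised_plane q) = loc_class q ` carrier (free_algebra {Lx, Ly, Linv})"
  by (simp add: localised_plane_def loc_class_def[abs_def] carrier_quotient)

lemma loc_class_closed [simp]: 
  "p \<in> carrier (free_algebra {Lx, Ly, Linv}) \<Longrightarrow> loc_class q p \<in> carrier (localised_plane q)"
  by (simp add: carrier_localised_plane)

lemma loc_class_add:
  "\<lbrakk>p \<in> carrier (free_algebra {Lx, Ly, Linv}); p' \<in> carrier (free_algebra {Lx, Ly, Linv})\<rbrakk> \<Longrightarrow>
     loc_class q p \<oplus>\<^bsub>localised_plane q\<^esub> loc_class q p' = loc_class q (p + p')"
  using lhom.hom_add by simp

lemma loc_class_mult:
  "\<lbrakk>p \<in> carrier (free_algebra {Lx, Ly, Linv}); p' \<in> carrier (free_algebra {Lx, Ly, Linv})\<rbrakk> \<Longrightarrow>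
     loc_class q p \<otimes>\<^bsub>localised_plane q\<^esub> loc_class q p' = loc_class q (p * p')"
  using lhom.hom_mult by simp

lemma loc_class_one: "\<one>\<^bsub>localised_plane q\<^esub> = loc_class q 1"
  using lhom.hom_one by simp

lemma loc_class_eq_iff:
  "\<lbrakk>p \<in> carrier (free_algebra {Lx, Ly, Linv}); p' \<in> carrier (free_algebra {Lx, Ly, Linv})\<rbrakk> \<Longrightarrow>
     loc_class q p = loc_class q p' \<longleftrightarrow> p - p' \<in> loc_ideal q"
  using I.quotient_eq_iff_same_a_r_cos[OF ideal_loc_ideal, of p p'] by (simp add: loc_class_def)

lemma self_mem_loc_class: 
  "p \<in> carrier (free_algebra {Lx, Ly, Linv}) \<Longrightarrow> p \<in> loc_class q p"
  using I.a_rcos_self by (simp add: loc_class_def)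

lemma loc_class_inv: "loc_class q (monomial [Linv, Lx, Ly]) = loc_class q 1"
proof -
  have "monomial [Linv, Lx, Ly] - 1 \<in> loc_ideal q"
    unfolding loc_ideal_def
    by (rule subsetD[OF I.genideal_self]) (auto simp: plane_relator_def)
  then show ?thesis
    by (subst loc_class_eq_iff) auto
qed

text \<open>The part of \<open>loc_ideal q\<close> inside the free algebra on \<open>x\<close> and
  \<open>y\<close> is an ideal there and contains the defining relator. The inclusion makes
  \<open>loc_map\<close> send cosets to cosets.\<close>

lemma plane_ideal_subset_loc_ideal: "plane_ideal q \<subseteq> loc_ideal q"
proof -
  have rel: "plane_relator q \<in> loc_ideal q"
    unfolding loc_ideal_def
    by (rule subsetD[OF I.genideal_self]) (auto simp: plane_relator_def)
  have sub: "plane_words \<subseteq> carrier (free_algebra {Lx, Ly, Linv})"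
    unfolding carrier_free_algebra subset_iff by blast
  have add: "a + b \<in> loc_ideal q" if "a \<in> loc_ideal q" "b \<in> loc_ideal q" for a b
    using additive_subgroup.a_closed[OF I.is_additive_subgroup that] by simp
  have neg: "- a \<in> loc_ideal q" if "a \<in> loc_ideal q" for a
    using I.I_l_closed[OF that, of "-1"] by (simp add: free_algebra_closed)
  have "ideal (loc_ideal q \<inter> plane_words) (free_algebra {Lx, Ly})"
  proof (rule idealI)
    show "ring (free_algebra {Lx, Ly})" by (rule ring_free_algebra)
    show "subgroup (loc_ideal q \<inter> plane_words) (add_monoid (free_algebra {Lx, Ly}))"
    proof (rule group.subgroupI)
      show "Group.group (add_monoid (free_algebra {Lx, Ly}))"
        using J.a_group .
      show "loc_ideal q \<inter> plane_words \<noteq> {}" 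
        using rel by (auto simp: plane_relator_def)
      show "inv\<^bsub>add_monoid (free_algebra {Lx, Ly})\<^esub> a \<in> loc_ideal q \<inter> plane_words"
        if "a \<in> loc_ideal q \<inter> plane_words" for a
      proof -
        have "\<ominus>\<^bsub>free_algebra {Lx, Ly}\<^esub> a = - a"
          by (rule J.minus_equality) (use that in auto)
        then show ?thesis using that neg by (auto simp: a_inv_def)
      qed
    qed (use add in auto)
  next
    fix a x assume "a \<in> loc_ideal q \<inter> plane_words" "x \<in> plane_words"
    then show "x \<otimes>\<^bsub>free_algebra {Lx, Ly}\<^esub> a \<in> loc_ideal q \<inter> plane_words"
        "a \<otimes>\<^bsub>free_algebra {Lx, Ly}\<^esub> x \<in> loc_ideal q \<inter> plane_words"
      using I.I_l_closed[of a x] I.I_r_closed[of a x] sub by auto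
  qed
  then have "plane_ideal q \<subseteq> loc_ideal q \<inter> plane_words"
    unfolding plane_ideal_def
    by (rule J.genideal_minimal) (use rel in \<open>auto simp: plane_relator_def\<close>)
  then show ?thesis by auto
qed

text \<open>Adding \<open>loc_ideal q\<close> to a coset of the smaller ideal absorbs that ideal, so
  a representative in the free algebra determines the image.\<close>

lemma loc_map_plane_class: 
  assumes p: "p \<in> plane_words"
  shows "loc_map q (plane_class q p) = loc_class q p"
proof -
  have add: "a + b \<in> loc_ideal q" if "a \<in> loc_ideal q" "b \<in> loc_ideal q" for a b
    using additive_subgroup.a_closed[OF I.is_additive_subgroup that] by simp
  have zero: "0 \<in> plane_ideal q"
    using additive_subgroup.zero_closed[OF J.is_additive_subgroup] by simp
  have "loc_map q (plane_class q p) = {a + (b + p) | a b. a \<in> loc_ideal q \<and> b \<in> plane_ideal q}"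
    by (auto simp: loc_map_def plane_class_def set_add_def' a_r_coset_def')
  also have "\<dots> = {a + p | a. a \<in> loc_ideal q}"
  proof safe
    fix a b assume "a \<in> loc_ideal q" "b \<in> plane_ideal q"
    then have "a + b \<in> loc_ideal q" using add plane_ideal_subset_loc_ideal by blast
    then show "\<exists>a'. a + (b + p) = a' + p \<and> a' \<in> loc_ideal q" by (metis add.assoc)
  next
    fix a assume "a \<in> loc_ideal q"
    then show "\<exists>a' b. a + p = a' + (b + p) \<and> a' \<in> loc_ideal q \<and> b \<in> plane_ideal q"
      using zero by (metis add.left_neutral)
  qed
  also have "\<dots> = loc_class q p"
    by (auto simp: loc_class_def a_r_coset_def')
  finally show ?thesis .
qed

end

subsection \<open>Modules over the quantum plane\<close>

text \<open>Action by representatives: computations can then take place in the free algebra, whose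
  sums and products are those of the type, instead of with cosets.\<close>

definition act :: "complex \<Rightarrow> (free_elem set, 'v) module \<Rightarrow> free_elem \<Rightarrow> 'v \<Rightarrow> 'v" where
  "act q M p v = plane_class q p \<odot>\<^bsub>M\<^esub> v"

locale plane_module =
  fixes q :: complex and M :: "(free_elem set, 'v) module" (structure)
  assumes left_module: "left_module (quantum_plane q) M"
begin

sublocale abelian_group M
  using left_module by (simp add: left_module_def)

lemma act_closed [simp, intro]:
  "\<lbrakk>p \<in> plane_words; v \<in> carrier M\<rbrakk> \<Longrightarrow> act q M p v \<in> carrier M"
  by (simp add: act_def left_module.smult_closed[OF left_module])

lemma act_add_left:
  "\<lbrakk>p \<in> plane_words; p' \<in> plane_words; v \<in> carrier M\<rbrakk> \<Longrightarrow>
     act q M (p + p') v = act q M p v \<oplus> act q M p' v"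
  using left_module.smult_l_distr[OF left_module, of "plane_class q p" "plane_class q p'" v]
  by (simp add: act_def plane_class_add)

lemma act_add_right:
  "\<lbrakk>p \<in> plane_words; v \<in> carrier M; v' \<in> carrier M\<rbrakk> \<Longrightarrow>
     act q M p (v \<oplus> v') = act q M p v \<oplus> act q M p v'"
  using left_module.smult_r_distr[OF left_module, of "plane_class q p" v v']
  by (simp add: act_def)

lemma act_mult:
  "\<lbrakk>p \<in> plane_words; p' \<in> plane_words; v \<in> carrier M\<rbrakk> \<Longrightarrow>
     act q M (p * p') v = act q M p (act q M p' v)"
  using left_module.smult_assoc[OF left_module, of "plane_class q p" "plane_class q p'" v]
  by (simp add: act_def plane_class_mult)

lemma act_one [simp]: "v \<in> carrier M \<Longrightarrow> act q M 1 v = v"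
  using left_module.smult_one[OF left_module, of v] by (simp add: act_def plane_class_one)

lemma act_zero_right [simp]:
  assumes "p \<in> plane_words" shows "act q M p \<zero> = \<zero>"
proof -
  have "act q M p \<zero> = act q M p \<zero> \<oplus> act q M p \<zero>"
    using act_add_right[OF assms, of \<zero> \<zero>] by simp
  then show ?thesis using assms by (metis act_closed add.r_cancel_one' zero_closed)
qed

lemma act_zero_left [simp]:
  assumes "v \<in> carrier M" shows "act q M 0 v = \<zero>"
proof -
  have "act q M 0 v = act q M 0 v \<oplus> act q M 0 v"
    using act_add_left[of 0 0 v] assms by simp
  then show ?thesis 
    using assms by (metis act_closed add.r_cancel_one' free_algebra_closed(1))
qed

lemma act_uminus:
  assumes "p \<in> plane_words" "v \<in> carrier M" shows "act q M (- p) v = \<ominus> act q M p v"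
proof -
  have "act q M (- p) v \<oplus> act q M p v = \<zero>"
    using act_add_left[of "-p" p v] assms by simp
  then show ?thesis using assms by (intro minus_equality[symmetric]) auto
qed

lemma act_diff_left:
  "\<lbrakk>p \<in> plane_words; p' \<in> plane_words; v \<in> carrier M\<rbrakk> \<Longrightarrow>
     act q M (p - p') v = act q M p v \<ominus> act q M p' v"
  using act_add_left[of p "- p'" v] by (simp add: act_uminus a_minus_def)

lemma act_const_const:
  "v \<in> carrier M \<Longrightarrow> act q M (const c) (act q M (const d) v) = act q M (const (c * d)) v"
  by (subst act_mult[symmetric]) (auto simp: const_mult)

lemma act_const_add:
  "v \<in> carrier M \<Longrightarrow> act q M (const c) v \<oplus> act q M (const d) v = act q M (const (c + d)) v"
  by (subst act_add_left[symmetric]) (auto simp: const_add)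

lemma act_const_commute:
  "\<lbrakk>p \<in> plane_words; v \<in> carrier M\<rbrakk> \<Longrightarrow>
     act q M p (act q M (const c) v) = act q M (const c) (act q M p v)"
  by (metis act_mult const_commute free_algebra_closed(3))

lemma act_const_one [simp]: "v \<in> carrier M \<Longrightarrow> act q M (const 1) v = v"
  by (simp add: const_one)

lemma act_const_cancel:
  assumes "act q M (const c) v = \<zero>" "c \<noteq> 0" "v \<in> carrier M"
  shows "v = \<zero>"
proof -
  have "v = act q M (const (inverse c)) (act q M (const c) v)"
    using assms(2,3) by (simp add: act_const_const)
  then show ?thesis using assms(1) by simp
qed

lemma submodule_iff:
  "submodule H (quantum_plane q) M \<longleftrightarrow>
     H \<subseteq> carrier M \<and> \<zero> \<in> H \<and> (\<forall>v\<in>H. \<forall>w\<in>H. v \<oplus> w \<in> H) \<and>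
     (\<forall>p\<in>plane_words. \<forall>v\<in>H. act q M p v \<in> H)"
proof safe
  assume "submodule H (quantum_plane q) M"
  then interpret submodule H "quantum_plane q" M .
  show "\<zero> \<in> H" using one_closed by simp
  show "v \<oplus> w \<in> H" if "v \<in> H" "w \<in> H" for v w using m_closed[OF that] by simp
  show "v \<in> carrier M" if "v \<in> H" for v using that mem_carrier by simp
  show "act q M p v \<in> H" if "p \<in> plane_words" "v \<in> H" for p v using that by (auto simp: act_def)
next
  assume *: "H \<subseteq> carrier M" "\<zero> \<in> H" "\<forall>v\<in>H. \<forall>w\<in>H. v \<oplus> w \<in> H" "\<forall>p\<in>plane_words. \<forall>v\<in>H. act q M p v \<in> H"
  show "submodule H (quantum_plane q) M"
  proof
    fix v assume v: "v \<in> H"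
    \<comment> \<open>Negatives are reached through the scalar -1.\<close>
    have "\<ominus> v = act q M (const (-1)) v"
      using v * act_uminus[of 1 v] by (auto simp: const_one single_uminus)
    then show "inv\<^bsub>add_monoid M\<^esub> v \<in> H" using v * by (simp add: a_inv_def)
  qed (use * in \<open>auto simp: carrier_quantum_plane act_def\<close>)
qed

lemma submodule_cyclic:
  assumes v: "v \<in> carrier M"
  shows "submodule {act q M p v | p. p \<in> plane_words} (quantum_plane q) M"
  unfolding submodule_iff
proof (intro conjI ballI subsetI)
  show "\<zero> \<in> {act q M p v | p. p \<in> plane_words}" using v by (auto intro!: exI[of _ 0])
next
  fix u w assume "u \<in> {act q M p v | p. p \<in> plane_words}" "w \<in> {act q M p v | p. p \<in> plane_words}"
  then show "u \<oplus> w \<in> {act q M p v | p. p \<in> plane_words}"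
    using v by (auto simp: act_add_left[symmetric])
qed (use v in \<open>auto simp: act_mult[symmetric]\<close>)

lemma generated_iff:
  "{r \<odot>\<^bsub>M\<^esub> v | r. r \<in> carrier (quantum_plane q)} = {act q M p v | p. p \<in> plane_words}"
  by (auto simp: carrier_quantum_plane act_def)

text \<open>The submodule generated by \<open>v\<close> contains \<open>1 v = v\<close>, so it is
  not zero, and simplicity leaves only the whole module.\<close>

lemma simple_cyclic:
  assumes "simple_module (quantum_plane q) M" "v \<in> carrier M" "v \<noteq> \<zero>"
  shows "carrier M = {act q M p v | p. p \<in> plane_words}"
proof -
  have "v \<in> {act q M p v | p. p \<in> plane_words}"
    using assms(2) act_one[of v] by (metis (mono_tags, lifting) free_algebra_closed(2) mem_Collect_eq)
  then show ?thesis
    using assms submodule_cyclic[OF assms(2)] unfolding simple_module_def by blast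
qed

end

lemma simple_module_plane_module: "simple_module (quantum_plane q) M \<Longrightarrow> plane_module q M"
  by (simp add: simple_module_def plane_module_def)

subsection \<open>Words in the quantum plane\<close>

abbreviation xy_word :: "nat \<Rightarrow> nat \<Rightarrow> letter list" where
  "xy_word a b \<equiv> replicate a Lx @ replicate b Ly"

lemma set_replicate_subset_iff [simp]: "set (replicate n l) \<subseteq> S \<longleftrightarrow> n = 0 \<or> l \<in> S"
  by (auto simp: set_replicate_conv_if)

lemma plane_monomial_eq: "plane_monomial q a b = plane_class q (monomial (xy_word a b))"
proof -
  have "monomial [l] ^ n = monomial (replicate n l)" for l :: letter and n
    by (induction n) (simp_all add: monomial_mult zero_word_def flip: single_one)
  then show ?thesis
    by (simp add: plane_monomial_def plane_class_pow plane_class_mult monomial_mult)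
qed

text \<open>The word \<open>w\<close> multiplies eigenvalues of \<open>x^a y^b\<close> by \<open>q\<close> to the power \<open>weight a b w\<close>.\<close>

definition weight :: "nat \<Rightarrow> nat \<Rightarrow> letter list \<Rightarrow> int" where
  "weight a b w = int a * int (count_list w Ly) - int b * int (count_list w Lx)"

text \<open>Membership of both sides is built in, so that the relation is a congruence for products
  and can be chained without side conditions.\<close>

definition plane_eq :: "complex \<Rightarrow> free_elem \<Rightarrow> free_elem \<Rightarrow> bool" where
  "plane_eq q p p' \<longleftrightarrow> p \<in> plane_words \<and> p' \<in> plane_words \<and> plane_class q p = plane_class q p'"

lemma plane_eq_refl: "p \<in> plane_words \<Longrightarrow> plane_eq q p p"
  by (simp add: plane_eq_def)

lemma plane_eq_sym: "plane_eq q p p' \<Longrightarrow> plane_eq q p' p"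
  by (simp add: plane_eq_def)

lemma plane_eq_trans [trans]: "plane_eq q p p' \<Longrightarrow> plane_eq q p' p'' \<Longrightarrow> plane_eq q p p''"
  by (simp add: plane_eq_def)

lemma plane_eq_mult: 
  "plane_eq q p p' \<Longrightarrow> plane_eq q r r' \<Longrightarrow> plane_eq q (p * r) (p' * r')"
  by (auto simp: plane_eq_def simp flip: plane_class_mult)

lemma plane_eq_act: "plane_eq q p p' \<Longrightarrow> act q M p v = act q M p' v"
  by (simp add: plane_eq_def act_def)

lemma const_assoc_swap: "p * (const c * r) = const c * (p * r)"
  by (metis const_commute mult.assoc)

lemma const_const_mult: "const c * (const d * p) = const (c * d) * p"
  by (simp add: const_mult flip: mult.assoc)

context
  fixes q :: complex
  assumes q: "q \<noteq> 0"
begin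

lemma plane_eq_yx: "plane_eq q (monomial [Ly, Lx]) (const (inverse q) * monomial [Lx, Ly])"
proof -
  have "plane_eq q (monomial [Lx, Ly]) (const q * monomial [Ly, Lx])"
    by (simp add: plane_eq_def plane_class_xy monomial_mult)
  then have "plane_eq q (const (inverse q) * monomial [Lx, Ly]) (const (inverse q) * (const q * monomial [Ly, Lx]))"
    by (intro plane_eq_mult plane_eq_refl) auto
  then show ?thesis
    using q by (simp add: const_const_mult const_one plane_eq_sym)
qed

text \<open>Moving \<open>y\<close> to the right past one \<open>x\<close> costs a factor
  \<open>inverse q\<close>, and there are \<open>i\<close> letters \<open>x\<close> to pass.\<close>

lemma y_xy_word:
  "plane_eq q (monomial (Ly # xy_word i j)) (const (q powi (- int i)) * monomial (xy_word i (Suc j)))"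
proof (induction i)
  case (Suc i)
  have "monomial (Ly # xy_word (Suc i) j) = monomial [Ly, Lx] * monomial (xy_word i j)"
    by (simp add: monomial_mult)
  also have "plane_eq q \<dots> ((const (inverse q) * monomial [Lx, Ly]) * monomial (xy_word i j))"
    by (intro plane_eq_mult plane_eq_yx plane_eq_refl) auto
  also have "\<dots> = const (inverse q) * (monomial [Lx] * monomial (Ly # xy_word i j))"
    by (simp add: monomial_mult mult.assoc)
  also have "plane_eq q \<dots> (const (inverse q) * (monomial [Lx] * 
      (const (q powi (- int i)) * monomial (xy_word i (Suc j)))))"
    by (intro plane_eq_mult Suc.IH plane_eq_refl) auto
  also have "\<dots> = const (inverse q * q powi (- int i)) * monomial (xy_word (Suc i) (Suc j))"
    by (simp add: monomial_mult)
  also have "inverse q * q powi (- int i) = q powi (- int (Suc i))"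
    by (simp only: power_int_minus power_int_of_nat power_Suc inverse_mult_distrib)
  finally show ?case .
qed (auto intro: plane_eq_refl simp: const_one)

lemma xy_word_x:
  "plane_eq q (monomial (xy_word i j @ [Lx])) (const (q powi (- int j)) * monomial (xy_word (Suc i) j))"
proof (induction j)
  case 0
  show ?case by (auto intro!: plane_eq_refl simp: const_one replicate_append_same)
next
  case (Suc j)
  \<comment> \<open>Splitting off the last \<open>y\<close> lets it meet the new \<open>x\<close>
    directly.\<close>
  have rep: "replicate (Suc j) l = replicate j l @ [l]" for l :: letter
    by (simp add: replicate_append_same)
  have "monomial (xy_word i (Suc j) @ [Lx]) = monomial (xy_word i j) * monomial [Ly, Lx]"
    unfolding rep by (simp add: monomial_mult)
  also have "plane_eq q \<dots> (monomial (xy_word i j) * (const (inverse q) * monomial [Lx, Ly]))"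
    by (intro plane_eq_mult plane_eq_yx plane_eq_refl) auto
  also have "\<dots> = const (inverse q) * (monomial (xy_word i j @ [Lx]) * monomial [Ly])"
    by (simp only: const_assoc_swap[of "monomial (xy_word i j)"]) (simp add: monomial_mult)
  also have "plane_eq q \<dots> (const (inverse q) * 
      ((const (q powi (- int j)) * monomial (xy_word (Suc i) j)) * monomial [Ly]))"
    by (intro plane_eq_mult Suc.IH plane_eq_refl) auto
  also have "\<dots> = const (inverse q * q powi (- int j)) * monomial (xy_word (Suc i) (Suc j))"
    unfolding mult.assoc const_const_mult rep by (simp add: monomial_mult)
  also have "inverse q * q powi (- int j) = q powi (- int (Suc j))"
    by (simp only: power_int_minus power_int_of_nat power_Suc inverse_mult_distrib)
  finally show ?case .
qed

text \<open>Normal form of words: a leading \<open>x\<close> is already in place, and a leading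
  \<open>y\<close> is moved past the sorted block of letters \<open>x\<close>.\<close>

lemma plane_eq_sorted:
  assumes "set w \<subseteq> {Lx, Ly}"
  shows "\<exists>m. plane_eq q (monomial w)
    (const (q powi m) * monomial (xy_word (count_list w Lx) (count_list w Ly)))"
  using assms
proof (induction w)
  case Nil
  show ?case by (auto intro!: exI[of _ 0] plane_eq_refl simp: const_one)
next
  case (Cons l w)
  let ?i = "count_list w Lx" and ?j = "count_list w Ly"
  obtain m where m: "plane_eq q (monomial w) (const (q powi m) * monomial (xy_word ?i ?j))"
    using Cons by auto
  have "monomial (l # w) = monomial [l] * monomial w"
    by (simp add: monomial_mult)
  also have "plane_eq q \<dots> (monomial [l] * (const (q powi m) * monomial (xy_word ?i ?j)))"
    using Cons.prems by (intro plane_eq_mult m plane_eq_refl) auto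
  also have "\<dots> = const (q powi m) * monomial (l # xy_word ?i ?j)"
    by (simp add: monomial_mult)
  finally have *: "plane_eq q (monomial (l # w)) (const (q powi m) * monomial (l # xy_word ?i ?j))" .
  show ?case
  proof (cases "l = Lx")
    case True
    then show ?thesis using * by auto
  next
    case False
    then have l: "l = Ly" using Cons.prems by auto
    note *
    also have "plane_eq q (const (q powi m) * monomial (l # xy_word ?i ?j)) 
      (const (q powi m) * (const (q powi (- int ?i)) * monomial (xy_word ?i (Suc ?j))))"
      unfolding l by (intro plane_eq_mult y_xy_word plane_eq_refl) auto
    also have "\<dots> = const (q powi (m - int ?i)) * monomial (xy_word ?i (Suc ?j))"
      unfolding const_const_mult using q by (simp add: power_int_minus power_int_diff field_simps)
    finally show ?thesis using l by auto
  qed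
qed

text \<open>Both words are multiples of the same sorted word, and the factors are powers of
  \<open>q\<close>, hence invertible.\<close>

lemma plane_eq_same_counts:
  assumes "set w \<subseteq> {Lx, Ly}" "set w' \<subseteq> {Lx, Ly}"
    and "count_list w Lx = count_list w' Lx" "count_list w Ly = count_list w' Ly"
  shows "\<exists>c. c \<noteq> 0 \<and> plane_eq q (monomial w) (const c * monomial w')"
proof -
  let ?K = "monomial (xy_word (count_list w Lx) (count_list w Ly))"
  obtain m m' where m: "plane_eq q (monomial w) (const (q powi m) * ?K)"
    and m': "plane_eq q (monomial w') (const (q powi m') * ?K)"
    using plane_eq_sorted[OF assms(1)] plane_eq_sorted[OF assms(2)] assms(3,4) by auto
  have "plane_eq q (const (q powi (m - m')) * monomial w') (const (q powi (m - m')) * (const (q powi m') * ?K))"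
    by (intro plane_eq_mult m' plane_eq_refl) auto
  also have "\<dots> = const (q powi m) * ?K"
    unfolding const_const_mult using q by (simp flip: power_int_add)
  also have "plane_eq q \<dots> (monomial w)" using m by (rule plane_eq_sym)
  finally have "plane_eq q (monomial w) (const (q powi (m - m')) * monomial w')" by (rule plane_eq_sym)
  then show ?thesis using q by (intro exI[of _ "q powi (m - m')"]) auto
qed

text \<open>With \<open>K = x^a y^b\<close>, sorting gives \<open>K x = q^(-b) x K\<close> and
  \<open>K y = q^a y K\<close>; along a word these exponents add up to its weight.\<close>

lemma xy_word_commute:
  assumes "set w \<subseteq> {Lx, Ly}"
  shows "plane_eq q (monomial (xy_word a b) * monomial w)
    (const (q powi weight a b w) * (monomial w * monomial (xy_word a b)))"
  using assms
proof (induction w)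
  case Nil
  show ?case by (auto intro!: plane_eq_refl simp: weight_def monomial_mult)
next
  case (Cons l w)
  let ?K = "monomial (xy_word a b)"
  have IH: "plane_eq q (?K * monomial w) (const (q powi weight a b w) * (monomial w * ?K))"
    using Cons by auto
  have step: "plane_eq q (?K * monomial [l]) (const (q powi weight a b [l]) * (monomial [l] * ?K))"
  proof (cases "l = Lx")
    case True
    then show ?thesis using xy_word_x[of a b] by (simp add: monomial_mult weight_def)
  next
    case False
    then have l: "l = Ly" using Cons.prems by auto
    have "plane_eq q (const (q powi int a) * monomial (Ly # xy_word a b)) 
       (const (q powi int a) * (const (q powi (- int a)) * monomial (xy_word a (Suc b))))"
      by (intro plane_eq_mult y_xy_word plane_eq_refl) auto
    also have "\<dots> = monomial (xy_word a (Suc b))"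
      unfolding const_const_mult using q by (simp add: const_one power_int_minus)
    finally show ?thesis
      using l by (simp add: monomial_mult weight_def replicate_append_same plane_eq_sym)
  qed
  have "?K * monomial (l # w) = ?K * monomial [l] * monomial w"
    by (simp add: monomial_mult)
  also have "plane_eq q \<dots> ((const (q powi weight a b [l]) * (monomial [l] * ?K)) * monomial w)"
    using Cons.prems by (intro plane_eq_mult step plane_eq_refl) auto
  also have "\<dots> = const (q powi weight a b [l]) * (monomial [l] * (?K * monomial w))"
    by (simp add: mult.assoc)
  also have "plane_eq q \<dots> (const (q powi weight a b [l]) * (monomial [l] *
       (const (q powi weight a b w) * (monomial w * ?K))))"
    by (rule plane_eq_mult[OF plane_eq_refl plane_eq_mult[OF plane_eq_refl IH]]) (use Cons.prems in auto)
  also have "\<dots> = const (q powi weight a b [l] * q powi weight a b w) * (monomial [l] * (monomial w * ?K))"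
    by (simp only: const_assoc_swap[of "monomial [l]"] const_const_mult)
  also have "monomial [l] * (monomial w * ?K) = monomial (l # w) * ?K"
    by (simp add: monomial_mult)
  also have "q powi weight a b [l] * q powi weight a b w = q powi weight a b (l # w)"
    using q by (simp add: weight_def algebra_simps flip: power_int_add)
  finally show ?case .
qed

lemma monomial_power: "monomial w ^ t = monomial (concat (replicate t w))"
  by (induction t) (simp_all add: monomial_mult zero_word_def flip: single_one)

text \<open>Weight zero says \<open>a j = b i\<close> for the numbers \<open>i\<close> and
  \<open>j\<close> of letters \<open>x\<close> and \<open>y\<close>. Coprimality makes
  \<open>(i, j)\<close> a multiple \<open>t (a, b)\<close>, and \<open>t\<close> copies of
  \<open>x^a y^b\<close> have the same letter counts.\<close>

lemma weight_zero_imp_power: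
  assumes w: "set w \<subseteq> {Lx, Ly}" and "weight a b w = 0" and ab: "coprime a b"
  shows "\<exists>c t. c \<noteq> 0 \<and> count_list w Lx = t * a \<and> count_list w Ly = t * b \<and>
    plane_eq q (monomial w) (const c * monomial (xy_word a b) ^ t)"
proof -
  have eq: "a * count_list w Ly = b * count_list w Lx"
    using assms(2) by (simp add: weight_def flip: of_nat_mult)
  have "\<exists>t. count_list w Lx = t * a \<and> count_list w Ly = t * b"
  proof (cases "a = 0")
    \<comment> \<open>Here coprimality forces \<open>b = 1\<close>, so there is no letter
      \<open>x\<close>, and \<open>t\<close> is the number of letters \<open>y\<close>.\<close>
    case True
    then show ?thesis using ab eq by auto
  next
    case False
    have "a dvd count_list w Lx" 
      using eq ab by (metis coprime_dvd_mult_right_iff dvd_triv_left)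
    then obtain t where "count_list w Lx = a * t" by (auto simp: dvd_def)
    then show ?thesis using eq False by (auto simp: mult_ac)
  qed
  then obtain t where t: "count_list w Lx = t * a" "count_list w Ly = t * b" by auto
  have count_concat: "count_list (concat (replicate t u)) l = t * count_list u l" for u :: "letter list" and l
    by (induction t) auto
  have count_rep: "count_list (replicate n l) l' = (if l = l' then n else 0)" for n and l l' :: letter
    by (induction n) auto
  let ?w = "concat (replicate t (xy_word a b))"
  have "\<exists>c. c \<noteq> 0 \<and> plane_eq q (monomial w) (const c * monomial ?w)"
    by (rule plane_eq_same_counts[OF w]) (auto simp: count_concat count_rep t)
  then show ?thesis unfolding monomial_power using t by blast
qed

end

subsection \<open>Projection onto a weight space\<close>

text \<open>Zero is allowed, so that a word maps eigenvectors to eigenvectors before anything is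
  known about injectivity.\<close>

definition eigenvector :: "complex \<Rightarrow> (free_elem set, 'v) module \<Rightarrow> free_elem \<Rightarrow> complex \<Rightarrow> 'v \<Rightarrow> bool" where
  "eigenvector q M k \<mu> v \<longleftrightarrow>
     v \<in> carrier M \<and> act q M k v = act q M (const \<mu>) v"

text \<open>A polynomial in \<open>k\<close> with roots \<open>cs\<close>: it annihilates every
  eigenvector whose eigenvalue is in the list and acts by a scalar on every other one.\<close>

definition shifted_product :: "free_elem \<Rightarrow> complex list \<Rightarrow> free_elem" where
  "shifted_product k cs = prod_list (map (\<lambda>c. k - const c) cs)"

lemma shifted_product_closed [simp]:
  "k \<in> plane_words \<Longrightarrow> shifted_product k cs \<in> plane_words"
  by (induction cs) (auto simp: shifted_product_def)

context plane_module
begin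

lemma act_shifted_product:
  assumes k: "k \<in> plane_words" and v: "eigenvector q M k \<nu> v"
  shows "act q M (shifted_product k cs) v = act q M (const (\<Prod>c\<leftarrow>cs. \<nu> - c)) v"
proof (induction cs)
  case Nil
  show ?case using v by (simp add: shifted_product_def eigenvector_def)
next
  case (Cons c cs)
  have vM: "v \<in> carrier M" and kv: "act q M k v = act q M (const \<nu>) v"
    using v by (auto simp: eigenvector_def)
  let ?P = "\<Prod>c\<leftarrow>cs. \<nu> - c"
  have "act q M (shifted_product k (c # cs)) v 
      = act q M (k - const c) (act q M (shifted_product k cs) v)"
    using k vM shifted_product_closed[OF k, of cs]
    by (subst act_mult[symmetric]) (auto simp: shifted_product_def)
  also have "\<dots> = act q M (k - const c) (act q M (const ?P) v)"
    by (simp only: Cons.IH)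
  also have "\<dots> = act q M (const ?P) (act q M (k - const c) v)"
    using k vM by (intro act_const_commute) auto
  also have "act q M (k - const c) v = act q M (const (\<nu> - c)) v"
    using k vM by (simp add: act_diff_left kv single_diff)
  also have "act q M (const ?P) (act q M (const (\<nu> - c)) v) = act q M (const ((\<nu> - c) * ?P)) v"
    using vM by (simp add: act_const_const mult.commute)
  finally show ?case by simp
qed

lemma act_power_eigenvector:
  assumes k: "k \<in> plane_words" and v: "eigenvector q M k \<nu> v"
  shows "act q M (k ^ t) v = act q M (const (\<nu> ^ t)) v"
proof (induction t)
  case (Suc t)
  have vM: "v \<in> carrier M" and kv: "act q M k v = act q M (const \<nu>) v"
    using v by (auto simp: eigenvector_def)
  have "act q M (k ^ Suc t) v = act q M k (act q M (const (\<nu> ^ t)) v)"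
    using k vM Suc by (simp add: act_mult)
  also have "\<dots> = act q M (const (\<nu> ^ t)) (act q M (const \<nu>) v)"
    using k vM by (simp only: act_const_commute kv)
  finally show ?case using vM by (simp add: act_const_const mult.commute)
qed (use v in \<open>simp add: eigenvector_def\<close>)

text \<open>The rule \<open>xy_word_commute\<close> moves \<open>x^a y^b\<close> past the word, at
  the cost of a power of \<open>q\<close>, until it meets \<open>v\<close>.\<close>

lemma eigenvector_word:
  assumes q: "q \<noteq> 0" and w: "set w \<subseteq> {Lx, Ly}" and v: "eigenvector q M (monomial (xy_word a b)) \<mu> v"
  shows "eigenvector q M (monomial (xy_word a b)) (\<mu> * q powi weight a b w) (act q M (monomial w) v)"
proof -
  let ?K = "monomial (xy_word a b)"
  have vM: "v \<in> carrier M" and kv: "act q M ?K v = act q M (const \<mu>) v"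
    using v by (auto simp: eigenvector_def)
  have wc: "monomial w \<in> plane_words" using w by simp
  have Kc: "?K \<in> plane_words" by simp
  have "act q M ?K (act q M (monomial w) v) = act q M (?K * monomial w) v"
    by (rule act_mult[symmetric]) (use w vM in auto)
  also have "\<dots> = act q M (const (q powi weight a b w) * (monomial w * ?K)) v"
    by (rule plane_eq_act[OF xy_word_commute[OF q w]])
  also have "\<dots> = act q M (const (q powi weight a b w)) (act q M (monomial w) (act q M ?K v))"
    using wc Kc vM by (simp add: act_mult free_algebra_closed(7) del: monomial_closed)
  also have "\<dots> = act q M (const (q powi weight a b w)) (act q M (const \<mu>) (act q M (monomial w) v))"
    unfolding kv using wc vM by (simp only: act_const_commute[OF wc])
  also have "\<dots> = act q M (const (\<mu> * q powi weight a b w)) (act q M (monomial w) v)"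
    using wc vM by (simp add: act_const_const mult.commute)
  finally show ?thesis using wc vM by (simp add: eigenvector_def)
qed

end

lemma generic_powi:
  assumes "q \<noteq> 0" "generic q" "q powi m = 1"
  shows "m = 0"
proof (rule ccontr)
  assume "m \<noteq> 0"
  then have "q ^ nat \<bar>m\<bar> = 1"
    using assms by (auto simp: power_int_def power_inverse split: if_splits)
  then show False using assms(2) \<open>m \<noteq> 0\<close> by (auto simp: generic_def)
qed

lemma generic_powi_inj:
  assumes "q \<noteq> 0" "generic q" "q powi m = q powi n"
  shows "m = n"
proof -
  have "q powi (m - n) = 1" using assms by (simp add: power_int_diff)
  then show ?thesis using generic_powi[OF assms(1,2)] by fastforce
qed

text \<open>Multiplying by a suitable product of factors \<open>K - \<mu> q^t\<close> kills the components of \<open>p v\<close> of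
  nonzero weight; on the component of weight zero \<open>p\<close> acts by a scalar which does not depend on
  the module.\<close>

lemma weight_zero_projection:
  fixes p :: free_elem and \<mu> :: complex
  assumes q: "q \<noteq> 0" and ab: "coprime a b" and p: "p \<in> plane_words"
  defines "K \<equiv> monomial (xy_word a b)"
  shows "\<exists>ts \<sigma>. 0 \<notin> set ts \<and> ((\<forall>w\<in>Poly_Mapping.keys p. weight a b (letters w) \<noteq> 0) \<longrightarrow> \<sigma> = 0) \<and>
    (\<forall>ts' (M :: (free_elem set, 'v) module) v. set ts \<subseteq> set ts' \<and> plane_module q M \<and> eigenvector q M K \<mu> v \<longrightarrow>
      act q M (shifted_product K (map (\<lambda>t. \<mu> * q powi t) ts') * p) v
       = act q M (const (\<sigma> * (\<Prod>t\<leftarrow>ts'. \<mu> - \<mu> * q powi t))) v)"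
  using p
proof (induction p rule: sparse_induct)
  case zero
  have "act q M (shifted_product K (map (\<lambda>t. \<mu> * q powi t) ts') * 0) v = act q M (const 0) v"
    if "plane_module q M" "eigenvector q M K \<mu> v" for M :: "(free_elem set, 'v) module" and v ts'
    using that by (simp add: eigenvector_def)
  then show ?case by (intro exI[of _ "[]"] exI[of _ 0]) auto
next
  case (add w c p)
  obtain u where u: "w = Word u" by (cases w)
  have uxy: "set u \<subseteq> {Lx, Ly}" and p: "p \<in> plane_words"
    using add.hyps add.prems unfolding carrier_free_algebra u by auto
  have Kc: "K \<in> plane_words" by (simp add: K_def)
  \<comment> \<open>The hypothesis covers every list containing \<open>ts\<close>, so it survives
    the addition of the weight of the new word.\<close>
  obtain ts \<sigma> where ts: "0 \<notin> set ts" 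
    and \<sigma>: "(\<forall>w\<in>Poly_Mapping.keys p. weight a b (letters w) \<noteq> 0) \<longrightarrow> \<sigma> = 0"
    and IH: "\<And>ts' (M :: (free_elem set, 'v) module) v. set ts \<subseteq> set ts' \<Longrightarrow> plane_module q M \<Longrightarrow> eigenvector q M K \<mu> v \<Longrightarrow>
      act q M (shifted_product K (map (\<lambda>t. \<mu> * q powi t) ts') * p) v
       = act q M (const (\<sigma> * (\<Prod>t\<leftarrow>ts'. \<mu> - \<mu> * q powi t))) v"
    using add.IH[OF p] by blast
  let ?n = "weight a b u"
  \<comment> \<open>The scalar \<open>s\<close> is the contribution of the word \<open>u\<close>. In
    weight zero \<open>u\<close> is a multiple \<open>d K^t\<close> and acts by
    \<open>d \<mu>^t\<close>; otherwise the contribution is 0.\<close>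
  obtain s where s0: "?n \<noteq> 0 \<Longrightarrow> s = 0" 
    and s: "\<And>(M :: (free_elem set, 'v) module) v. ?n = 0 \<Longrightarrow> plane_module q M \<Longrightarrow> eigenvector q M K \<mu> v \<Longrightarrow>
      act q M (monomial u) v = act q M (const s) v"
  proof (cases "?n = 0")
    case True
    obtain d t where dt: "plane_eq q (monomial u) (const d * K ^ t)"
      using weight_zero_imp_power[OF q uxy True ab] by (auto simp: K_def)
    have "act q M (monomial u) v = act q M (const (d * \<mu> ^ t)) v" 
      if M: "plane_module q M" and v: "eigenvector q M K \<mu> v" for M :: "(free_elem set, 'v) module" and v
    proof -
      interpret plane_module q M by fact
      have "act q M (monomial u) v = act q M (const d * K ^ t) v"
        by (rule plane_eq_act[OF dt])
      also have "\<dots> = act q M (const d) (act q M (const (\<mu> ^ t)) v)"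
        using v Kc act_power_eigenvector[OF Kc v, of t] by (simp add: act_mult eigenvector_def)
      finally show ?thesis using v by (simp add: act_const_const eigenvector_def)
    qed
    then show ?thesis using that[of "d * \<mu> ^ t"] True by blast
  qed (use that[of 0] in auto)
  \<comment> \<open>A nonzero weight joins the list, so that the factor belonging to its eigenvalue
    kills \<open>u v\<close>.\<close>
  let ?ts = "(if ?n = 0 then [] else [?n]) @ ts"
  have "act q M (shifted_product K (map (\<lambda>t. \<mu> * q powi t) ts') * (Poly_Mapping.single w c + p)) v
       = act q M (const ((c * s + \<sigma>) * (\<Prod>t\<leftarrow>ts'. \<mu> - \<mu> * q powi t))) v"
    if ts': "set ?ts \<subseteq> set ts'" and M: "plane_module q M" and v: "eigenvector q M K \<mu> v" 
    for M :: "(free_elem set, 'v) module" and v ts'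
  proof -
    interpret plane_module q M by fact
    let ?R = "shifted_product K (map (\<lambda>t. \<mu> * q powi t) ts')" 
    let ?\<rho> = "\<Prod>t\<leftarrow>ts'. \<mu> - \<mu> * q powi t"
    let ?u = "monomial u :: free_elem"
    have vM: "v \<in> carrier M" using v by (simp add: eigenvector_def)
    have Rc: "?R \<in> plane_words" using Kc by simp
    have uc: "?u \<in> plane_words" using uxy by simp
    have single: "Poly_Mapping.single w c = const c * ?u" by (simp add: u monomial_mult)
    have main: "act q M ?R (act q M ?u v) = act q M (const (s * ?\<rho>)) v"
    proof (cases "?n = 0")
      case True
      have "act q M ?R (act q M ?u v) = act q M (const s) (act q M ?R v)"
        using s[OF True M v] Rc vM by (simp only: act_const_commute[OF Rc])
      also have "act q M ?R v = act q M (const ?\<rho>) v"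
        using act_shifted_product[OF Kc v] by (simp add: comp_def)
      finally show ?thesis using vM by (simp add: act_const_const)
    next
      case False
      have "?n \<in> set ts'" using ts' False by auto
      then have z: "(\<Prod>t\<leftarrow>ts'. \<mu> * q powi ?n - \<mu> * q powi t) = 0"
        by (induction ts') auto
      have "act q M ?R (act q M ?u v) = act q M (const (\<Prod>t\<leftarrow>ts'. \<mu> * q powi ?n - \<mu> * q powi t)) (act q M ?u v)"
        using act_shifted_product[OF Kc eigenvector_word[OF q uxy v[unfolded K_def], folded K_def]] 
        by (simp add: comp_def)
      then show ?thesis using s0[OF False] vM uc by (simp add: z)
    qed
    have "act q M (?R * (Poly_Mapping.single w c + p)) v 
       = act q M ?R (act q M (const c * ?u + p) v)"
      unfolding single using Rc uc p vM by (intro act_mult) auto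
    also have "\<dots> = act q M (const c) (act q M ?R (act q M ?u v)) \<oplus>\<^bsub>M\<^esub> act q M (?R * p) v"
      using Rc uc p vM by (simp add: act_add_left act_add_right act_mult act_const_commute[OF Rc] free_algebra_closed(3,7) del: monomial_closed)
    also have "act q M (?R * p) v = act q M (const (\<sigma> * ?\<rho>)) v"
      using IH[OF _ M v] ts' by auto
    finally show ?thesis 
      using vM by (simp add: main act_const_const act_const_add algebra_simps)
  qed
  moreover have "c * s + \<sigma> = 0" 
    if "\<forall>w\<in>Poly_Mapping.keys (Poly_Mapping.single w c + p). weight a b (letters w) \<noteq> 0"
    using that[unfolded add.hyps] \<sigma> s0 u by auto
  moreover have "0 \<notin> set ?ts" using ts by auto
  ultimately show ?case by blast
qed

text \<open>The weight zero scalar of \<open>p\<close> vanishes because \<open>p\<close> kills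
  \<open>v\<close>. It is the same scalar for \<open>v'\<close>, yet \<open>p\<close> fixes
  \<open>v'\<close>, so \<open>v'\<close> must be zero.\<close>

lemma eigenvector_transfer:
  fixes M M' :: "(free_elem set, 'v) module"
  assumes q: "q \<noteq> 0" "generic q" and ab: "coprime a b" and p: "p \<in> plane_words"
    and "\<mu> \<noteq> 0" and M: "plane_module q M" "plane_module q M'"
    and v: "eigenvector q M (monomial (xy_word a b)) \<mu> v" 
    and v': "eigenvector q M' (monomial (xy_word a b)) \<mu> v'" 
    and pv: "act q M p v = \<zero>\<^bsub>M\<^esub>" and pv': "act q M' p v' = v'"
    and "v \<noteq> \<zero>\<^bsub>M\<^esub>"
  shows "v' = \<zero>\<^bsub>M'\<^esub>"
proof -
  interpret M: plane_module q M by fact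
  interpret M': plane_module q M' by fact
  let ?K = "monomial (xy_word a b) :: free_elem"
  obtain ts \<sigma> where ts: "0 \<notin> set ts" 
    and *: "\<And>(M :: (free_elem set, 'v) module) v. plane_module q M \<Longrightarrow> eigenvector q M ?K \<mu> v \<Longrightarrow>
      act q M (shifted_product ?K (map (\<lambda>t. \<mu> * q powi t) ts) * p) v
       = act q M (const (\<sigma> * (\<Prod>t\<leftarrow>ts. \<mu> - \<mu> * q powi t))) v"
    using weight_zero_projection[OF q(1) ab p, where 'v = 'v and \<mu> = \<mu>] by blast
  let ?R = "shifted_product ?K (map (\<lambda>t. \<mu> * q powi t) ts)" and ?\<rho> = "\<Prod>t\<leftarrow>ts. \<mu> - \<mu> * q powi t"
  \<comment> \<open>A factor \<open>\<mu> - \<mu> q^t\<close> could vanish only for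
    \<open>t = 0\<close>, which the list omits.\<close>
  have \<rho>: "?\<rho> \<noteq> 0"
    using ts \<open>\<mu> \<noteq> 0\<close> generic_powi[OF q] by (induction ts) auto
  have Rc: "?R \<in> plane_words" by simp
  have vM: "v \<in> carrier M" "v' \<in> carrier M'" using v v' by (auto simp: eigenvector_def)
  have "act q M (const (\<sigma> * ?\<rho>)) v = \<zero>\<^bsub>M\<^esub>"
    using *[OF M(1) v] M.act_mult[OF Rc p vM(1)] pv M.act_zero_right[OF Rc] by simp
  then have "\<sigma> * ?\<rho> = 0" using M.act_const_cancel vM \<open>v \<noteq> \<zero>\<^bsub>M\<^esub>\<close> by blast
  moreover have "act q M' ?R v' = act q M' (const (\<sigma> * ?\<rho>)) v'"
    using *[OF M(2) v'] M'.act_mult[OF Rc p vM(2)] pv' by metis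
  ultimately have "act q M' ?R v' = \<zero>\<^bsub>M'\<^esub>"
    using vM by (simp only: const_zero M'.act_zero_left)
  moreover have "act q M' ?R v' = act q M' (const ?\<rho>) v'"
    using M'.act_shifted_product[OF _ v', of "map (\<lambda>t. \<mu> * q powi t) ts"] by (simp add: comp_def)
  ultimately show ?thesis using M'.act_const_cancel \<rho> vM by metis
qed

text \<open>All words of \<open>p\<close> move \<open>v\<close> to other eigenvalues, so the weight
  zero scalar of \<open>p\<close> is 0 although \<open>p\<close> fixes \<open>v\<close>. This later
  excludes exponents \<open>a = 0\<close> and \<open>b = 0\<close>.\<close>

lemma (in plane_module) eigenvector_weights:
  assumes q: "q \<noteq> 0" "generic q" and ab: "coprime a b" and p: "p \<in> plane_words"
    and "\<mu> \<noteq> 0" and v: "eigenvector q M (monomial (xy_word a b)) \<mu> v" 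
    and wt: "\<forall>w\<in>Poly_Mapping.keys p. weight a b (letters w) \<noteq> 0"
    and pv: "act q M p v = v"
  shows "v = \<zero>"
proof -
  let ?K = "monomial (xy_word a b) :: free_elem"
  obtain ts where ts: "0 \<notin> set ts" 
    and *: "\<And>M v. plane_module q M \<Longrightarrow> eigenvector q M ?K \<mu> v \<Longrightarrow>
      act q (M :: (free_elem set, 'v) module) (shifted_product ?K (map (\<lambda>t. \<mu> * q powi t) ts) * p) v
       = act q M (const 0) v"
    using weight_zero_projection[OF q(1) ab p, where 'v = 'v and \<mu> = \<mu>] wt by (metis (no_types, lifting) mult_zero_left order_refl)
  let ?R = "shifted_product ?K (map (\<lambda>t. \<mu> * q powi t) ts)" and ?\<rho> = "\<Prod>t\<leftarrow>ts. \<mu> - \<mu> * q powi t"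
  have \<rho>: "?\<rho> \<noteq> 0"
    using ts \<open>\<mu> \<noteq> 0\<close> generic_powi[OF q] by (induction ts) auto
  have Rc: "?R \<in> plane_words" by simp
  have vM: "v \<in> carrier M" using v by (auto simp: eigenvector_def)
  have "act q M ?R v = \<zero>"
    using *[OF plane_module_axioms v] act_mult[OF Rc p vM] pv vM by simp
  moreover have "act q M ?R v = act q M (const ?\<rho>) v"
    using act_shifted_product[OF _ v, of "map (\<lambda>t. \<mu> * q powi t) ts"] by (simp add: comp_def)
  ultimately show ?thesis using act_const_cancel \<rho> vM by metis
qed

subsection \<open>Uniqueness of the modules \<open>L\<close>\<close>

text \<open>Bezout gives an integer solution, and adding \<open>s\<close> times
  \<open>(a, b)\<close> to \<open>(i, j)\<close> does not change the difference. For large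
  \<open>s\<close> both entries are nonnegative.\<close>

lemma ex_weight_counts:
  assumes "0 < a" "0 < b" "coprime a b"
  shows "\<exists>i j. int a * int j - int b * int i = n"
proof -
  obtain u v where uv: "u * int a + v * int b = 1"
    using assms(3) bezout_int[of "int a" "int b"] by (metis coprime_int_iff coprime_iff_gcd_eq_1)
  \<comment> \<open>As \<open>a\<close> and \<open>b\<close> are at least 1, this \<open>s\<close>
    outweighs both \<open>n u\<close> and \<open>n v\<close>.\<close>
  define s where "s = \<bar>n * u\<bar> + \<bar>n * v\<bar>"
  have s: "s \<le> int a * s" "s \<le> int b * s" "- s \<le> n * u" "n * v \<le> s"
    using assms by (auto simp: s_def mult_le_cancel_right1)
  have "0 \<le> n * u + int b * s" "0 \<le> int a * s - n * v"
    using s by linarith+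
  moreover have "int a * (n * u + int b * s) - int b * (int a * s - n * v) = n * (u * int a + v * int b)"
    by (simp add: algebra_simps)
  ultimately show ?thesis
    using uv by (intro exI[of _ "nat (int a * s - n * v)"] exI[of _ "nat (n * u + int b * s)"]) simp
qed

lemma weight_append: "weight a b (u @ w) = weight a b u + weight a b w"
  by (simp add: weight_def algebra_simps)

lemma count_list_replicate: "count_list (replicate n l) l' = (if l = l' then n else 0)"
  by (induction n) auto

lemma weight_xy_word: "weight a b (xy_word i j) = int a * int j - int b * int i"
  by (simp add: weight_def count_list_replicate)

text \<open>A word of weight \<open>n\<close> moves \<open>v\<close> to the new eigenvalue. The
  image is not zero, since a word of weight \<open>-n\<close> brings it back to a nonzero multiple
  of \<open>v\<close>.\<close>

lemma (in plane_module) eigenvector_shift: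
  assumes q: "q \<noteq> 0" and ab: "0 < a" "0 < b" "coprime a b"
    and v: "eigenvector q M (monomial (xy_word a b)) \<mu> v" "\<mu> \<noteq> 0" "v \<noteq> \<zero>"
  shows "\<exists>u. u \<noteq> \<zero> \<and> eigenvector q M (monomial (xy_word a b)) (\<mu> * q powi n) u"
proof -
  obtain i j where n: "int a * int j - int b * int i = n"
    using ex_weight_counts[OF ab] by blast
  obtain i' j' where n': "int a * int j' - int b * int i' = - n"
    using ex_weight_counts[OF ab] by blast
  let ?w = "xy_word i j" and ?w' = "xy_word i' j'"
  have vM: "v \<in> carrier M" using v by (simp add: eigenvector_def)
  have "set (?w' @ ?w) \<subseteq> {Lx, Ly}" "weight a b (?w' @ ?w) = 0"
    using n n' by (simp_all only: weight_append[of _ _ ?w' ?w] weight_xy_word) auto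
  then obtain c t where c: "c \<noteq> 0"
    "plane_eq q (monomial (?w' @ ?w)) (const c * monomial (xy_word a b) ^ t)"
    using weight_zero_imp_power[OF q _ _ ab(3)] by blast
  have "act q M (monomial ?w') (act q M (monomial ?w) v) = act q M (monomial (?w' @ ?w)) v"
    using vM act_mult[of "monomial ?w'" "monomial ?w" v] by (simp add: monomial_mult)
  also have "\<dots> = act q M (const c * monomial (xy_word a b) ^ t) v"
    by (rule plane_eq_act[OF c(2)])
  also have "\<dots> = act q M (const (c * \<mu> ^ t)) v"
    using vM act_power_eigenvector[OF _ v(1), of t] by (simp add: act_mult free_algebra_power_closed act_const_const)
  finally have "act q M (monomial ?w) v \<noteq> \<zero>"
    using act_const_cancel[of "c * \<mu> ^ t" v] vM v c(1) by auto
  moreover have "eigenvector q M (monomial (xy_word a b)) (\<mu> * q powi n) (act q M (monomial ?w) v)"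
    using eigenvector_word[OF q _ v(1), of ?w] n by (simp add: weight_xy_word)
  ultimately show ?thesis by blast
qed

lemma (in plane_module) act_diff_eq_zero_iff:
  assumes "p \<in> plane_words" "p' \<in> plane_words" "v \<in> carrier M"
  shows "act q M (p - p') v = \<zero> \<longleftrightarrow> act q M p v = act q M p' v"
proof
  assume "act q M (p - p') v = \<zero>"
  then show "act q M p v = act q M p' v"
    using act_add_left[of "p - p'" p' v] assms by simp
qed (use assms in \<open>simp add: act_diff_left a_minus_def r_neg\<close>)

text \<open>The vectors \<open>v\<close> and \<open>v'\<close> have the same annihilator, so sending
  \<open>p v\<close> to \<open>p v'\<close> is well defined and injective; it is onto because
  \<open>v'\<close> generates.\<close>

lemma isomorphic_by_eigenvectors:
  fixes M M' :: "(free_elem set, 'v) module"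
  assumes q: "q \<noteq> 0" "generic q" and ab: "coprime a b" and "\<mu> \<noteq> 0" 
    and M: "simple_module (quantum_plane q) M" and M': "simple_module (quantum_plane q) M'"
    and v: "eigenvector q M (monomial (xy_word a b)) \<mu> v" "v \<noteq> \<zero>\<^bsub>M\<^esub>" 
    and v': "eigenvector q M' (monomial (xy_word a b)) \<mu> v'" "v' \<noteq> \<zero>\<^bsub>M'\<^esub>" 
  shows "isomorphic_modules (quantum_plane q) M M'"
proof -
  interpret M: plane_module q M by (rule simple_module_plane_module) fact
  interpret M': plane_module q M' by (rule simple_module_plane_module) fact
  have vM: "v \<in> carrier M" "v' \<in> carrier M'" using v v' by (auto simp: eigenvector_def)
  have cyc: "carrier M = {act q M p v | p. p \<in> plane_words}" "carrier M' = {act q M' p v' | p. p \<in> plane_words}"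
    using M.simple_cyclic[OF M] M'.simple_cyclic[OF M'] vM v v' by blast+
  have 1: "act q M' p v' = \<zero>\<^bsub>M'\<^esub>" if "act q M p v = \<zero>\<^bsub>M\<^esub>" "p \<in> plane_words" for p
  proof (rule ccontr)
    assume "act q M' p v' \<noteq> \<zero>\<^bsub>M'\<^esub>"
    \<comment> \<open>By simplicity some \<open>r\<close> takes \<open>p v'\<close> back to
      \<open>v'\<close>, whereas \<open>r p\<close> kills \<open>v\<close>;
      \<open>eigenvector_transfer\<close> forbids this.\<close>
    then have "carrier M' = {act q M' r (act q M' p v') | r. r \<in> plane_words}"
      using that vM by (intro M'.simple_cyclic M') auto
    then have "v' \<in> {act q M' r (act q M' p v') | r. r \<in> plane_words}"
      using vM(2) by (rule subst)
    then obtain r where "r \<in> plane_words" "act q M' r (act q M' p v') = v'"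
      by force
    then show False
      using eigenvector_transfer[OF q ab _ \<open>\<mu> \<noteq> 0\<close> M.plane_module_axioms M'.plane_module_axioms v(1) v'(1), of "r * p"]
        that vM v v' by (simp add: M.act_mult M'.act_mult free_algebra_closed(7))
  qed
  have 2: "act q M p v = \<zero>\<^bsub>M\<^esub>" if "act q M' p v' = \<zero>\<^bsub>M'\<^esub>" "p \<in> plane_words" for p
  proof (rule ccontr)
    assume "act q M p v \<noteq> \<zero>\<^bsub>M\<^esub>"
    then have "carrier M = {act q M r (act q M p v) | r. r \<in> plane_words}"
      using that vM by (intro M.simple_cyclic M) auto
    then have "v \<in> {act q M r (act q M p v) | r. r \<in> plane_words}"
      using vM(1) by (rule subst)
    then obtain r where "r \<in> plane_words" "act q M r (act q M p v) = v"
      by force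
    then show False
      using eigenvector_transfer[OF q ab _ \<open>\<mu> \<noteq> 0\<close> M'.plane_module_axioms M.plane_module_axioms v'(1) v(1), of "r * p"]
        that vM v v' by (simp add: M.act_mult M'.act_mult free_algebra_closed(7))
  qed
  have eq_iff: "act q M p v = act q M p' v \<longleftrightarrow> act q M' p v' = act q M' p' v'"
    if "p \<in> plane_words" "p' \<in> plane_words" for p p'
  proof -
    have "act q M p v = act q M p' v \<longleftrightarrow> act q M (p - p') v = \<zero>\<^bsub>M\<^esub>"
      using that vM by (simp add: M.act_diff_eq_zero_iff)
    also have "\<dots> \<longleftrightarrow> act q M' (p - p') v' = \<zero>\<^bsub>M'\<^esub>"
      using 1 2 that by (meson free_algebra_closed(6))
    also have "\<dots> \<longleftrightarrow> act q M' p v' = act q M' p' v'"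
      using that vM by (simp add: M'.act_diff_eq_zero_iff)
    finally show ?thesis .
  qed
  \<comment> \<open>Any \<open>p\<close> with \<open>p v = u\<close> may be chosen, because by
    \<open>eq_iff\<close> the vector \<open>p v'\<close> depends on \<open>u\<close> only.\<close>
  define f where "f u = act q M' (SOME p. p \<in> plane_words \<and> act q M p v = u) v'" for u
  have f: "f (act q M p v) = act q M' p v'" if "p \<in> plane_words" for p
  proof -
    have "(SOME p'. p' \<in> plane_words \<and> act q M p' v = act q M p v) \<in> plane_words \<and> 
       act q M (SOME p'. p' \<in> plane_words \<and> act q M p' v = act q M p v) v = act q M p v"
      by (rule someI[of _ p]) (use that in auto)
    then show ?thesis unfolding f_def using eq_iff that by blast
  qed
  show ?thesis
    unfolding isomorphic_modules_def
  proof (intro exI[of _ f] conjI ballI)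
    show "bij_betw f (carrier M) (carrier M')"
      unfolding bij_betw_def
    proof
      show "inj_on f (carrier M)" unfolding cyc(1) using f eq_iff by (auto simp: inj_on_def)
      show "f ` carrier M = carrier M'" unfolding cyc using f by (force simp: image_def)
    qed
  next
    fix u w assume "u \<in> carrier M" "w \<in> carrier M"
    then obtain p p' where "p \<in> plane_words" "p' \<in> plane_words" "u = act q M p v" "w = act q M p' v"
      unfolding cyc(1) by blast
    then show "f (u \<oplus>\<^bsub>M\<^esub> w) = f u \<oplus>\<^bsub>M'\<^esub> f w"
      using vM f by (simp flip: M.act_add_left M'.act_add_left add: free_algebra_closed)
  next
    fix r u assume "r \<in> carrier (quantum_plane q)" "u \<in> carrier M"
    then obtain p p' where "p \<in> plane_words" "p' \<in> plane_words" "u = act q M p v" "r = plane_class q p'"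
      unfolding cyc(1) carrier_quantum_plane by blast
    then show "f (r \<odot>\<^bsub>M\<^esub> u) = r \<odot>\<^bsub>M'\<^esub> f u"
      using vM f by (simp flip: M.act_mult M'.act_mult act_def add: free_algebra_closed)
  qed
qed

text \<open>Preimages of submodules under \<open>f\<close> are submodules, so simplicity is carried
  over. That \<open>f\<close> preserves zero follows from the action of the element 0.\<close>

lemma simple_module_isomorphic:
  assumes M: "simple_module (quantum_plane q) M" and N: "left_module (quantum_plane q) N"
    and f: "bij_betw f (carrier M) (carrier N)"
      "\<And>v w. \<lbrakk>v \<in> carrier M; w \<in> carrier M\<rbrakk> \<Longrightarrow> f (v \<oplus>\<^bsub>M\<^esub> w) = f v \<oplus>\<^bsub>N\<^esub> f w"
      "\<And>p v. \<lbrakk>p \<in> plane_words; v \<in> carrier M\<rbrakk> \<Longrightarrow> f (act q M p v) = act q N p (f v)"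
  shows "simple_module (quantum_plane q) N" "f \<zero>\<^bsub>M\<^esub> = \<zero>\<^bsub>N\<^esub>"
proof -
  interpret M: plane_module q M by (rule simple_module_plane_module) fact
  interpret N: plane_module q N by (rule plane_module.intro) fact
  have fM: "f v \<in> carrier N" if "v \<in> carrier M" for v
    using f(1) that by (auto simp: bij_betw_def)
  show zero: "f \<zero>\<^bsub>M\<^esub> = \<zero>\<^bsub>N\<^esub>"
    using f(3)[of 0 "\<zero>\<^bsub>M\<^esub>"] fM by simp
  have inj: "inj_on f (carrier M)" and surj: "f ` carrier M = carrier N"
    using f(1) by (auto simp: bij_betw_def)
  show "simple_module (quantum_plane q) N"
    unfolding simple_module_def
  proof (intro conjI allI impI)
    show "carrier N \<noteq> {\<zero>\<^bsub>N\<^esub>}"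
    proof
      assume N0: "carrier N = {\<zero>\<^bsub>N\<^esub>}"
      have "v = \<zero>\<^bsub>M\<^esub>" if "v \<in> carrier M" for v
        using fM[OF that] N0 zero inj_onD[OF inj, of v "\<zero>\<^bsub>M\<^esub>"] that by auto
      then show False using M by (auto simp: simple_module_def)
    qed
  next
    fix H assume H: "submodule H (quantum_plane q) N"
    let ?H = "{v \<in> carrier M. f v \<in> H}"
    have "submodule ?H (quantum_plane q) M"
      using H zero f(2,3) unfolding M.submodule_iff N.submodule_iff by auto
    then have "?H = {\<zero>\<^bsub>M\<^esub>} \<or> ?H = carrier M" using M by (auto simp: simple_module_def)
    moreover have "H = f ` ?H" using H surj unfolding N.submodule_iff by auto
    ultimately show "H = {\<zero>\<^bsub>N\<^esub>} \<or> H = carrier N" using zero surj by force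
  qed (rule N)
qed

text \<open>In a simple module every nonzero vector generates, so an eigenvector is all that has to
  be found.\<close>

lemma mem_L_iff:
  assumes M: "simple_module (quantum_plane q) M"
  shows "M \<in> L q a b \<Lambda> \<longleftrightarrow> 
    (\<exists>\<mu>\<in>\<Lambda>. \<exists>v. v \<noteq> \<zero>\<^bsub>M\<^esub> \<and> eigenvector q M (monomial (xy_word a b)) \<mu> v)"
proof -
  interpret M: plane_module q M by (rule simple_module_plane_module) fact
  show ?thesis
    using M M.simple_cyclic[OF M] 
    unfolding L_def mem_Collect_eq M.generated_iff eigenvector_def plane_monomial_eq act_def[symmetric]
    by blast
qed

text \<open>An isomorphism carries eigenvectors to eigenvectors. Conversely, the eigenvalues of two
  members of \<open>L q a b \<Lambda>\<close> differ by a power of \<open>q\<close>; shifting one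
  eigenvector makes them equal, and \<open>isomorphic_by_eigenvectors\<close> applies.\<close>

lemma iso_class_eq_L:
  fixes M :: "(free_elem set, 'v) module"
  assumes q: "q \<noteq> 0" "generic q" and ab: "(a, b) \<in> P_red" and \<Lambda>: "\<Lambda> \<in> Cstar_mod_q q"
    and M: "M \<in> L q a b \<Lambda>"
  shows "iso_class (quantum_plane q) M = L q a b \<Lambda>"
proof (intro equalityI subsetI)
  have ab': "0 < a" "0 < b" "coprime a b" using ab by (auto simp: P_red_def)
  have sM: "simple_module (quantum_plane q) M" using M by (simp add: L_def)
  interpret M: plane_module q M by (rule simple_module_plane_module) (rule sM)
  obtain \<mu> v where \<mu>: "\<mu> \<in> \<Lambda>" and v: "v \<noteq> \<zero>\<^bsub>M\<^esub>" "eigenvector q M (monomial (xy_word a b)) \<mu> v"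
    using M mem_L_iff[OF sM] by blast
  have vM: "v \<in> carrier M" using v by (simp add: eigenvector_def)
  obtain \<nu> where \<nu>: "\<nu> \<noteq> 0" "\<Lambda> = q_class q \<nu>" using \<Lambda> by (auto simp: Cstar_mod_q_def)
  obtain m where m: "\<mu> = \<nu> * q powi m" using \<mu> \<nu> by (auto simp: q_class_def)
  have \<mu>0: "\<mu> \<noteq> 0" using m \<nu> q by simp
  show "N \<in> L q a b \<Lambda>" if iso: "N \<in> iso_class (quantum_plane q) M" for N
  proof -
    obtain f where f: "bij_betw f (carrier M) (carrier N)"
      "\<forall>v\<in>carrier M. \<forall>w\<in>carrier M. f (v \<oplus>\<^bsub>M\<^esub> w) = f v \<oplus>\<^bsub>N\<^esub> f w"
      "\<forall>r\<in>carrier (quantum_plane q). \<forall>v\<in>carrier M. f (r \<odot>\<^bsub>M\<^esub> v) = r \<odot>\<^bsub>N\<^esub> f v"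
      and N: "left_module (quantum_plane q) N"
      using iso by (auto simp: iso_class_def isomorphic_modules_def)
    have fp: "f (act q M p v) = act q N p (f v)" if "p \<in> plane_words" "v \<in> carrier M" for p v
      using f(3) that by (simp add: act_def)
    note sN = simple_module_isomorphic[OF sM N f(1) f(2)[rule_format] fp]
    have "f v \<noteq> \<zero>\<^bsub>N\<^esub>" 
      using v vM sN(2) f(1) inj_onD[of f "carrier M" v "\<zero>\<^bsub>M\<^esub>"] by (auto simp: bij_betw_def)
    moreover have "eigenvector q N (monomial (xy_word a b)) \<mu> (f v)"
      using v vM f(1) fp[of "monomial (xy_word a b)" v] fp[of "const \<mu>" v] 
      by (auto simp: eigenvector_def bij_betw_def)
    ultimately show ?thesis using mem_L_iff[OF sN(1)] \<mu> by blast
  qed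
  show "N \<in> iso_class (quantum_plane q) M" if N: "N \<in> L q a b \<Lambda>" for N
  proof -
    have sN: "simple_module (quantum_plane q) N" using N by (simp add: L_def)
    interpret N: plane_module q N by (rule simple_module_plane_module) (rule sN)
    obtain \<mu>' w where \<mu>': "\<mu>' \<in> \<Lambda>" and w: "w \<noteq> \<zero>\<^bsub>N\<^esub>" "eigenvector q N (monomial (xy_word a b)) \<mu>' w"
      using N mem_L_iff[OF sN] by blast
    obtain m' where m': "\<mu>' = \<nu> * q powi m'" using \<mu>' \<nu> by (auto simp: q_class_def)
    have "\<mu>' \<noteq> 0" using m' \<nu> q by simp
    then obtain u where "u \<noteq> \<zero>\<^bsub>N\<^esub>" "eigenvector q N (monomial (xy_word a b)) (\<mu>' * q powi (m - m')) u"
      using N.eigenvector_shift[OF q(1) ab' w(2)] w(1) by blast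
    moreover have "\<mu>' * q powi (m - m') = \<mu>" using m m' q by (simp add: power_int_diff)
    ultimately show ?thesis
      using isomorphic_by_eigenvectors[OF q ab'(3) \<mu>0 sM sN v(2,1)] sN
      by (auto simp: iso_class_def simple_module_def)
  qed
qed

subsection \<open>Tensor products\<close>

text \<open>Since the relators lie in the free abelian group on the given pairs, what they generate
  is a subgroup, and cosets can be compared by differences.\<close>

lemma tensor_relators_subset:
  fixes R :: "'r ring" and B :: "'b ring" and M :: "('r, 'v) module"
  assumes "ring B" "\<And>r. r \<in> carrier R \<Longrightarrow> \<iota> r \<in> carrier B" "left_module R M"
  shows "tensor_relators R B \<iota> M \<subseteq> carrier (free_Abelian_group (carrier B \<times> carrier M))"
proof -
  interpret B: ring B by fact
  interpret M: left_module R M by fact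
  have diff: "frag_of x - frag_of y \<in> carrier (free_Abelian_group S)" if "x \<in> S" "y \<in> S"
    for x y and S :: "('b \<times> 'v) set"
    using that keys_diff[of "frag_of x" "frag_of y"] by (auto split: if_splits)
  have diff3: "frag_of x - frag_of y - frag_of z \<in> carrier (free_Abelian_group S)" if "x \<in> S" "y \<in> S" "z \<in> S"
    for x y z and S :: "('b \<times> 'v) set"
    using that keys_diff[of "frag_of x - frag_of y" "frag_of z"] diff[of x S y] by (fastforce split: if_splits)
  show ?thesis
    unfolding tensor_relators_def
    apply (intro Un_least subsetI; elim CollectE exE conjE; hypsubst)
    subgoal by (rule diff3) auto
    subgoal by (rule diff3) auto
    subgoal by (rule diff) (auto intro: assms(2) M.smult_closed)
    done
qed

lemma subgroup_tensor_kernel: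
  assumes "ring B" "\<And>r. r \<in> carrier R \<Longrightarrow> \<iota> r \<in> carrier B" "left_module R M"
  shows "subgroup (tensor_kernel R B \<iota> M) (free_Abelian_group (carrier B \<times> carrier M))"
  unfolding tensor_kernel_def
  by (intro group.generate_is_subgroup group_free_Abelian_group tensor_relators_subset assms)

lemma pure_tensor_eq_iff:
  assumes "ring B" "\<And>r. r \<in> carrier R \<Longrightarrow> \<iota> r \<in> carrier B" "left_module R M"
    and "b \<in> carrier B" "b' \<in> carrier B" "v \<in> carrier M" "v' \<in> carrier M"
  shows "pure_tensor R B \<iota> M b v = pure_tensor R B \<iota> M b' v' \<longleftrightarrow> 
    frag_of (b, v) - frag_of (b', v') \<in> tensor_kernel R B \<iota> M"
proof -
  let ?G = "free_Abelian_group (carrier B \<times> carrier M)" and ?H = "tensor_kernel R B \<iota> M"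
  interpret H: subgroup ?H ?G by (rule subgroup_tensor_kernel[OF assms(1-3)])
  have coset: "?H #>\<^bsub>?G\<^esub> x = {h + x | h. h \<in> ?H}" for x
    by (auto simp: r_coset_def)
  have zero: "0 \<in> ?H" and add: "\<And>x y. x \<in> ?H \<Longrightarrow> y \<in> ?H \<Longrightarrow> x + y \<in> ?H"
    using H.one_closed H.m_closed by auto
  have neg: "- x \<in> ?H" if "x \<in> ?H" for x
    using H.m_inv_closed[OF that] H.mem_carrier[OF that] by simp
  have "{h + x | h. h \<in> ?H} = {h + y | h. h \<in> ?H} \<longleftrightarrow> x - y \<in> ?H" for x y
  proof
    assume "{h + x | h. h \<in> ?H} = {h + y | h. h \<in> ?H}"
    moreover have "x \<in> {h + x | h. h \<in> ?H}" using zero by force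
    ultimately obtain h where "h \<in> ?H" "x = h + y" by blast
    then show "x - y \<in> ?H" by simp
  next
    assume d: "x - y \<in> ?H"
    have "h + x \<in> {h + y | h. h \<in> ?H}" if "h \<in> ?H" for h
      using add[OF that d] by (intro CollectI exI[of _ "h + (x - y)"]) simp
    moreover have "h + y \<in> {h + x | h. h \<in> ?H}" if "h \<in> ?H" for h
      using add[OF that neg[OF d]] by (intro CollectI exI[of _ "h + - (x - y)"]) simp
    ultimately show "{h + x | h. h \<in> ?H} = {h + y | h. h \<in> ?H}" by blast
  qed
  then show ?thesis unfolding pure_tensor_def coset .
qed

lemma pure_tensor_balanced:
  assumes "ring B" "\<And>r. r \<in> carrier R \<Longrightarrow> \<iota> r \<in> carrier B" "left_module R M"
    and "b \<in> carrier B" "r \<in> carrier R" "v \<in> carrier M"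
  shows "pure_tensor R B \<iota> M (b \<otimes>\<^bsub>B\<^esub> \<iota> r) v = pure_tensor R B \<iota> M b (r \<odot>\<^bsub>M\<^esub> v)"
proof -
  interpret B: ring B by fact
  interpret M: left_module R M by fact
  have "frag_of (b \<otimes>\<^bsub>B\<^esub> \<iota> r, v) - frag_of (b, r \<odot>\<^bsub>M\<^esub> v) \<in> tensor_kernel R B \<iota> M"
    unfolding tensor_kernel_def
    by (rule generate.incl) (use assms(4-) in \<open>auto simp: tensor_relators_def\<close>)
  then show ?thesis
    using assms by (subst pure_tensor_eq_iff) (auto intro: M.smult_closed)
qed

lemma ring_localised_plane: "ring (localised_plane q)"
  unfolding localised_plane_def by (rule ideal.quotient_is_ring[OF ideal_loc_ideal])

lemma plane_words_subset: "plane_words \<subseteq> carrier (free_algebra {Lx, Ly, Linv})"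
  unfolding carrier_free_algebra subset_iff by blast

lemma loc_map_closed: "r \<in> carrier (quantum_plane q) \<Longrightarrow> loc_map q r \<in> carrier (localised_plane q)"
  using plane_words_subset by (auto simp: carrier_quantum_plane loc_map_plane_class)

text \<open>Write \<open>1 = Linv (x y)\<close> and move the factor \<open>x y\<close> across the
  tensor sign. Hence \<open>kappa\<close> can be injective only if \<open>x y\<close> acts
  injectively.\<close>

lemma (in plane_module) kappa_factor:
  assumes v: "v \<in> carrier M"
  shows "kappa q M v = pure_tensor (quantum_plane q) (localised_plane q) (loc_map q) M
     (loc_class q (monomial [Linv])) (act q M (monomial [Lx, Ly]) v)"
proof -
  have "\<one>\<^bsub>localised_plane q\<^esub> = loc_class q (monomial [Linv]) \<otimes>\<^bsub>localised_plane q\<^esub> loc_map q (plane_class q (monomial [Lx, Ly]))"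
    by (simp add: loc_map_plane_class loc_class_mult loc_class_one flip: loc_class_inv)
      (simp add: monomial_mult)
  then show ?thesis
    unfolding kappa_def act_def using v
    by (simp add: pure_tensor_balanced[OF ring_localised_plane _ left_module] loc_map_closed)
qed

context plane_module
begin

lemma kappa_inj_imp_xy:
  assumes "inj_on (kappa q M) (carrier M)" "v \<in> carrier M" "act q M (monomial [Lx, Ly]) v = \<zero>"
  shows "v = \<zero>"
proof -
  have "kappa q M v = kappa q M \<zero>"
    using assms by (simp add: kappa_factor)
  then show ?thesis using assms by (auto dest: inj_onD)
qed

text \<open>The last letter \<open>l\<close> of the word acts first, and \<open>l v = 0\<close>
  implies \<open>x y v = 0\<close>: directly for \<open>l = y\<close>, and through
  \<open>x y = q y x\<close> for \<open>l = x\<close>.\<close>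

lemma kappa_inj_imp_word:
  assumes q: "q \<noteq> 0" and inj: "inj_on (kappa q M) (carrier M)"
    and "v \<in> carrier M" "set w \<subseteq> {Lx, Ly}" "act q M (monomial w) v = \<zero>"
  shows "v = \<zero>"
  using assms(3-)
proof (induction w arbitrary: v rule: rev_induct)
  case Nil
  then show ?case by (simp add: const_one)
next
  case (snoc l w)
  have l: "l = Lx \<or> l = Ly" and w: "set w \<subseteq> {Lx, Ly}" using snoc.prems by auto
  have lw: "act q M (monomial w) (act q M (monomial [l]) v) = \<zero>"
    using snoc.prems act_mult[of "monomial w" "monomial [l]" v] by (simp add: monomial_mult)
  have lv: "act q M (monomial [l]) v = \<zero>"
    by (rule snoc.IH[OF _ w lw]) (use snoc.prems l in auto)
  have xy: "act q M (monomial [Lx, Ly]) v = act q M (monomial [Lx]) (act q M (monomial [Ly]) v)"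
    using snoc.prems act_mult[of "monomial [Lx]" "monomial [Ly]" v] by (simp add: monomial_mult)
  have yx: "act q M (const q * monomial [Ly, Lx]) v 
     = act q M (const q * monomial [Ly]) (act q M (monomial [Lx]) v)"
    using snoc.prems act_mult[of "const q * monomial [Ly]" "monomial [Lx]" v] by (simp add: monomial_mult)
  have "act q M (monomial [Lx, Ly]) v = \<zero>"
    using l
  proof
    assume "l = Ly"
    then show ?thesis using xy lv by simp
  next
    assume "l = Lx"
    then show ?thesis using yx lv plane_class_xy[of q] by (simp add: act_def) (simp flip: act_def add: monomial_mult)
  qed
  then show ?case using kappa_inj_imp_xy[OF inj] snoc.prems by blast
qed

end

subsection \<open>Polynomials in an element\<close>

text \<open>Elements of \<open>C[D]\<close> are written as complex polynomials evaluated at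
  \<open>D\<close>, which gives access to degrees, roots and division with remainder.\<close>

definition eval_poly_at :: "free_elem \<Rightarrow> complex poly \<Rightarrow> free_elem" where
  "eval_poly_at k P = fold_coeffs (\<lambda>c r. const c + k * r) P 0"

lemma eval_poly_at_0 [simp]: "eval_poly_at k 0 = 0"
  by (simp add: eval_poly_at_def)

lemma eval_poly_at_pCons [simp]: "eval_poly_at k (pCons c P) = const c + k * eval_poly_at k P"
  by (cases "P = 0 \<and> c = 0") (auto simp: eval_poly_at_def)

lemma eval_poly_at_closed [simp]: 
  "k \<in> plane_words \<Longrightarrow> eval_poly_at k P \<in> plane_words"
  by (induction P) (auto intro!: free_algebra_closed)

lemma eval_poly_at_add: "eval_poly_at k (P + Q) = eval_poly_at k P + eval_poly_at k Q"
  by (induction P Q rule: poly_induct2) (simp_all add: algebra_simps single_add)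

lemma eval_poly_at_smult: "eval_poly_at k (Polynomial.smult c P) = const c * eval_poly_at k P"
  by (induction P) (simp_all add: algebra_simps const_mult const_assoc_swap)

lemma eval_poly_at_monom: "eval_poly_at k (Polynomial.monom c n) = const c * k ^ n"
proof (induction n)
  case (Suc n)
  then show ?case by (simp add: monom_Suc const_assoc_swap)
qed (simp add: monom_0)

lemma eval_poly_at_linear_mult:
  "eval_poly_at k ([:- \<mu>, 1:] * P) = (k - const \<mu>) * eval_poly_at k P"
proof -
  have "[:- \<mu>, 1:] * P = Polynomial.smult (- \<mu>) P + pCons 0 P" by simp
  then show ?thesis
    by (simp only: eval_poly_at_add eval_poly_at_smult eval_poly_at_pCons) (simp add: algebra_simps single_uminus)
qed

lemma eval_poly_at_sum_monom:
  "eval_poly_at k (\<Sum>i\<le>d. Polynomial.monom (c i) i) = (\<Sum>i\<le>d. const (c i) * k ^ i)"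
  by (induction d) (simp_all add: eval_poly_at_add eval_poly_at_monom)

lemma polynomials_in_plane_class:
  assumes k: "k \<in> plane_words"
  shows "polynomials_in q (plane_class q k) = {plane_class q (eval_poly_at k P) | P. True}"
proof -
  interpret ring "quantum_plane q" by (rule ring_quantum_plane)
  have "finsum (quantum_plane q)
        (\<lambda>i. plane_scalar q (c i) \<otimes>\<^bsub>quantum_plane q\<^esub> (plane_class q k [^]\<^bsub>quantum_plane q\<^esub> i)) {..d}
     = plane_class q (\<Sum>i\<le>d. const (c i) * k ^ i)" for c and d :: nat
  proof (induction d)
    case 0
    then show ?case using k by (simp add: plane_class_pow plane_class_mult free_algebra_closed)
  next
    case (Suc d)
    have "(\<Sum>i\<le>d. const (c i) * k ^ i) \<in> plane_words"
      using k by (simp flip: eval_poly_at_sum_monom)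
    moreover have "(\<lambda>i. plane_scalar q (c i) \<otimes>\<^bsub>quantum_plane q\<^esub> (plane_class q k [^]\<^bsub>quantum_plane q\<^esub> i)) \<in> {..Suc d} \<rightarrow> carrier (quantum_plane q)"
      using k by auto
    ultimately show ?case 
      using k Suc.IH 
      by (simp add: finsum_Suc) (simp add: plane_class_pow plane_class_mult plane_class_add free_algebra_closed add.commute free_algebra_power_closed power_commutes)
  qed
  then have "polynomials_in q (plane_class q k) = 
     {plane_class q (eval_poly_at k (\<Sum>i\<le>d. Polynomial.monom (c i) i)) | c d. True}"
    by (simp add: polynomials_in_def eval_poly_at_sum_monom)
  also have "\<dots> = {plane_class q (eval_poly_at k P) | P. True}"
    by (auto) (metis poly_as_sum_of_monoms)
  finally show ?thesis .
qed

context plane_module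
begin

text \<open>Split off a root \<open>\<mu>\<close> of \<open>P\<close>. Either the cofactor already
  kills \<open>w\<close>, or it maps \<open>w\<close> to an eigenvector with eigenvalue
  \<open>\<mu>\<close>.\<close>

lemma exists_eigenvector:
  assumes k: "k \<in> plane_words" and "P \<noteq> 0" "w \<in> carrier M" "w \<noteq> \<zero>" "act q M (eval_poly_at k P) w = \<zero>"
  shows "\<exists>u \<mu>. u \<noteq> \<zero> \<and> eigenvector q M k \<mu> u"
  using assms(2-)
proof (induction "Polynomial.degree P" arbitrary: P)
  case 0
  then obtain c where "P = [:c:]" "c \<noteq> 0" by (metis degree_eq_zeroE pCons_0_0)
  then show ?case using 0 act_const_cancel[of c w] by simp
next
  case (Suc n)
  have "\<not> constant (poly P)" using Suc.hyps(2) by (simp add: constant_degree)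
  then obtain \<mu> where "poly P \<mu> = 0" using fundamental_theorem_of_algebra by blast
  then obtain P' where P': "P = [:- \<mu>, 1:] * P'" by (auto simp: poly_eq_0_iff_dvd dvd_def)
  with Suc.prems have "P' \<noteq> 0" by auto
  then have deg: "n = Polynomial.degree P'" using Suc.hyps(2) unfolding P' by (subst (asm) degree_mult_eq) auto
  let ?u = "act q M (eval_poly_at k P') w"
  have uM: "?u \<in> carrier M" using k Suc.prems by simp
  have Pc: "eval_poly_at k P' \<in> plane_words" using k by simp
  show ?case
  proof (cases "?u = \<zero>")
    case True
    then show ?thesis using Suc.hyps(1)[OF deg \<open>P' \<noteq> 0\<close>] Suc.prems by blast
  next
    case False
    have "act q M (k - const \<mu>) ?u = \<zero>"
      using Suc.prems k unfolding P' eval_poly_at_linear_mult by (simp add: act_mult free_algebra_closed)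
    then have "eigenvector q M k \<mu> ?u"
      using uM k by (simp add: eigenvector_def act_diff_eq_zero_iff)
    then show ?thesis using False by blast
  qed
qed

lemma complex_subspace_iff:
  "complex_subspace q M W \<longleftrightarrow> W \<subseteq> carrier M \<and> \<zero> \<in> W \<and> (\<forall>v\<in>W. \<forall>w\<in>W. v \<oplus> w \<in> W) \<and>
     (\<forall>c. \<forall>v\<in>W. act q M (const c) v \<in> W)"
proof safe
  assume W: "complex_subspace q M W"
  then interpret subgroup W "add_monoid M" by (simp add: complex_subspace_def)
  show "\<zero> \<in> W" using one_closed by simp
  show "v \<oplus> w \<in> W" if "v \<in> W" "w \<in> W" for v w using m_closed[OF that] by simp
  show "v \<in> carrier M" if "v \<in> W" for v using that mem_carrier by simp
  show "act q M (const c) v \<in> W" if "v \<in> W" for c v using that W by (simp add: complex_subspace_def act_def)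
next
  assume *: "W \<subseteq> carrier M" "\<zero> \<in> W" "\<forall>v\<in>W. \<forall>w\<in>W. v \<oplus> w \<in> W" "\<forall>c. \<forall>v\<in>W. act q M (const c) v \<in> W"
  have "\<ominus> v \<in> W" if v: "v \<in> W" for v
  proof -
    have "\<ominus> v = act q M (const (-1)) v"
      using v * act_uminus[of 1 v] by (auto simp: const_one single_uminus)
    then show ?thesis using v * by simp
  qed
  then have "subgroup W (add_monoid M)"
    using * by (unfold_locales) (auto simp: a_inv_def)
  then show "complex_subspace q M W" using * by (simp add: complex_subspace_def act_def)
qed

text \<open>The finitely many spanning vectors come from polynomials of degree at most some
  \<open>N\<close>. Then \<open>k^(N+1) w\<close> is also given by a polynomial of degree at most
  \<open>N\<close>, and the difference of the two polynomials is not zero.\<close>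

lemma locally_finite_annihilator:
  assumes k: "k \<in> plane_words" and w: "w \<in> carrier M"
    and fin: "finite_dimensional q M {act q M (eval_poly_at k P) w | P. True}"
  shows "\<exists>P. P \<noteq> 0 \<and> act q M (eval_poly_at k P) w = \<zero>"
proof -
  let ?W = "{act q M (eval_poly_at k P) w | P. True}"
  obtain F where F: "finite F" "F \<subseteq> ?W" "?W = complex_span q M F"
    using fin by (auto simp: finite_dimensional_def)
  have "\<forall>f\<in>F. \<exists>P. f = act q M (eval_poly_at k P) w" using F(2) by blast
  then obtain h where h: "\<And>f. f \<in> F \<Longrightarrow> f = act q M (eval_poly_at k (h f)) w" by metis
  \<comment> \<open>The inserted 0 keeps the maximum meaningful for empty \<open>F\<close>.\<close>
  define N where "N = Max (insert 0 (Polynomial.degree ` h ` F))"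
  have N: "Polynomial.degree (h f) \<le> N" if "f \<in> F" for f
    using F(1) that by (auto simp: N_def intro!: Max_ge)
  let ?S = "{act q M (eval_poly_at k P) w | P. Polynomial.degree P \<le> N}"
  have "complex_subspace q M ?S"
    unfolding complex_subspace_iff
  proof (intro conjI ballI allI subsetI)
    show "\<zero> \<in> ?S" using w by (auto intro!: exI[of _ 0])
  next
    fix u v assume "u \<in> ?S" "v \<in> ?S"
    then obtain P Q where "u = act q M (eval_poly_at k P) w" "v = act q M (eval_poly_at k Q) w" 
      "Polynomial.degree P \<le> N" "Polynomial.degree Q \<le> N" by blast
    then show "u \<oplus> v \<in> ?S" using k w
      by (intro CollectI exI[of _ "P + Q"]) (auto simp: eval_poly_at_add act_add_left degree_add_le)
  next
    fix c v assume "v \<in> ?S"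
    then obtain P where "v = act q M (eval_poly_at k P) w" "Polynomial.degree P \<le> N" by blast
    then show "act q M (const c) v \<in> ?S" using k w
      by (intro CollectI exI[of _ "Polynomial.smult c P"]) 
        (auto simp: eval_poly_at_smult act_mult intro: order_trans[OF degree_smult_le])
  qed (use k w in auto)
  moreover have "F \<subseteq> ?S" using h N by blast
  ultimately have "?W \<subseteq> ?S" unfolding F(3) complex_span_def by blast
  moreover have "act q M (eval_poly_at k (Polynomial.monom 1 (Suc N))) w \<in> ?W" by blast
  ultimately obtain P where P: "act q M (eval_poly_at k (Polynomial.monom 1 (Suc N))) w = act q M (eval_poly_at k P) w" "Polynomial.degree P \<le> N"
    by blast
  have "Polynomial.degree (Polynomial.monom (1::complex) (Suc N)) \<noteq> Polynomial.degree P" using P(2) by (simp add: degree_monom_eq)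
  then have "Polynomial.monom 1 (Suc N) - P \<noteq> 0" by auto
  moreover have "eval_poly_at k (Polynomial.monom 1 (Suc N) - P) = eval_poly_at k (Polynomial.monom 1 (Suc N)) - eval_poly_at k P"
    using eval_poly_at_add[of k "Polynomial.monom 1 (Suc N) - P" P] by simp
  ultimately show ?thesis using P(1) k w by (metis act_diff_eq_zero_iff eval_poly_at_closed)
qed

end

subsection \<open>Simple admissible modules are of the form \<open>L\<close>\<close>

text \<open>Each summand is zero or all of \<open>M\<close>, and they cannot all be zero, so one of
  them is \<open>M\<close>.\<close>

lemma simple_admissible_locally_finite:
  assumes "simple_admissible q M"
  obtains m n where "(m, n) \<noteq> (0, 0)" "M \<in> locally_finite_cat q m n"
proof -
  have simple: "simple_module (quantum_plane q) M" and "admissible q M"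
    using assms by (auto simp: simple_admissible_def)
  interpret plane_module q M by (rule simple_module_plane_module) (rule simple)
  obtain k N where N: "\<forall>j<k. submodule (N j) (quantum_plane q) M" "carrier M = finite_sum_of M k N"
    "\<forall>j<k. \<exists>m n. (m, n) \<noteq> (0, 0) \<and> M\<lparr>carrier := N j\<rparr> \<in> locally_finite_cat q m n"
    using \<open>admissible q M\<close> by (auto simp: admissible_def)
  have "\<exists>j<k. N j = carrier M"
  proof (rule ccontr)
    assume "\<not> ?thesis"
    then have "\<forall>j<k. N j = {\<zero>\<^bsub>M\<^esub>}" using N(1) simple by (auto simp: simple_module_def)
    then have "finsum M u {..<k} = \<zero>\<^bsub>M\<^esub>" if "\<forall>j<k. u j \<in> N j" for u
      using that by (intro add.finprod_one_eqI) auto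
    then have "carrier M \<subseteq> {\<zero>\<^bsub>M\<^esub>}" unfolding N(2) finite_sum_of_def by blast
    then show False using simple by (auto simp: simple_module_def)
  qed
  then obtain j where "j < k" "N j = carrier M" by blast
  moreover from \<open>j < k\<close> obtain m n where "(m, n) \<noteq> (0, 0)" "M\<lparr>carrier := N j\<rparr> \<in> locally_finite_cat q m n"
    using N(3) by blast
  ultimately show ?thesis using that[of m n] by simp
qed

text \<open>First an eigenvector \<open>v\<close> of \<open>D = x^m y^n\<close> is found. With
  \<open>(m, n) = t (a, b)\<close>, \<open>D\<close> is a multiple of \<open>K^t\<close>, so a
  nonzero polynomial in \<open>K\<close> kills \<open>v\<close>, and \<open>K\<close> has an
  eigenvector.\<close>

lemma (in plane_module) primitive_eigenvector:
  assumes q: "q \<noteq> 0" and mn: "(m, n) \<noteq> (0, 0)" and fin: "M \<in> locally_finite_cat q m n"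
    and nz: "carrier M \<noteq> {\<zero>}"
  obtains a b u \<mu> where "coprime a b" "u \<noteq> \<zero>" "eigenvector q M (monomial (xy_word a b)) \<mu> u"
proof -
  define g where "g = gcd m n"
  have g: "g > 0" using mn by (auto simp: g_def)
  obtain a b where ab: "m = g * a" "n = g * b" "coprime a b"
    using gcd_coprime_exists[of m n] g unfolding g_def by (metis mult.commute neq0_conv)
  let ?D = "monomial (xy_word m n) :: free_elem" and ?K = "monomial (xy_word a b) :: free_elem"
  obtain w where w: "w \<in> carrier M" "w \<noteq> \<zero>" using nz by auto
  have "{r \<odot>\<^bsub>M\<^esub> w | r. r \<in> polynomials_in q (plane_monomial q m n)} = {act q M (eval_poly_at ?D P) w | P. True}"
    by (auto simp: plane_monomial_eq polynomials_in_plane_class act_def)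
  moreover have "finite_dimensional q M {r \<odot>\<^bsub>M\<^esub> w | r. r \<in> polynomials_in q (plane_monomial q m n)}"
    using fin w by (simp add: locally_finite_cat_def)
  ultimately obtain P where "P \<noteq> 0" "act q M (eval_poly_at ?D P) w = \<zero>"
    using locally_finite_annihilator[of ?D w] w by auto
  then obtain v \<nu> where v: "v \<noteq> \<zero>" "eigenvector q M ?D \<nu> v"
    using exists_eigenvector[of ?D P w] w by auto
  have vM: "v \<in> carrier M" using v by (simp add: eigenvector_def)
  have "weight a b (xy_word m n) = 0" using ab by (simp add: weight_xy_word)
  then obtain c t where c: "c \<noteq> 0" "m = t * a" "n = t * b" "plane_eq q ?D (const c * ?K ^ t)"
    using weight_zero_imp_power[OF q, of "xy_word m n" a b] ab(3) by (auto simp: count_list_replicate)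
  have "t \<noteq> 0" using c mn by (cases t) auto
  \<comment> \<open>The polynomial \<open>c X^t - \<nu>\<close>, evaluated at \<open>K\<close>,
    kills \<open>v\<close>. As \<open>t > 0\<close>, its coefficient at \<open>t\<close> is
    \<open>c\<close>, so it is not zero.\<close>
  let ?P = "Polynomial.monom c t - [:\<nu>:]"
  have "Polynomial.coeff ?P t = c" using \<open>t \<noteq> 0\<close> by (cases t) auto
  then have P0: "?P \<noteq> 0" using c(1) by (metis coeff_0)
  have ev: "eval_poly_at ?K ?P = const c * ?K ^ t - const \<nu>"
    using eval_poly_at_add[of ?K ?P "[:\<nu>:]"] by (simp add: eval_poly_at_monom)
  have "act q M (const c * ?K ^ t) v = act q M (const \<nu>) v"
    using v(2) plane_eq_act[OF c(4), of M v] by (simp add: eigenvector_def)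
  then have "act q M (eval_poly_at ?K ?P) v = \<zero>"
    unfolding ev using vM by (subst act_diff_eq_zero_iff) (auto intro!: free_algebra_closed)
  then obtain u \<mu> where "u \<noteq> \<zero>" "eigenvector q M ?K \<mu> u"
    using exists_eigenvector[OF _ P0 vM v(1), of ?K] by auto
  then show ?thesis using that ab(3) by blast
qed

lemma (in plane_module) simple_eigenvector_positive:
  assumes q: "q \<noteq> 0" "generic q" and simple: "simple_module (quantum_plane q) M"
    and inj: "inj_on (kappa q M) (carrier M)" and ab: "coprime a b" and "\<mu> \<noteq> 0"
    and u: "u \<noteq> \<zero>" "eigenvector q M (monomial (xy_word a b)) \<mu> u"
  shows "0 < a \<and> 0 < b"
proof (rule ccontr)
  assume "\<not> ?thesis"
  then have "a = 0 \<and> b = 1 \<or> a = 1 \<and> b = 0"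
    using ab coprime_0_left_iff[of b] coprime_0_right_iff[of a] by (cases "a = 0") simp_all
  \<comment> \<open>The letter that changes the weight: it lowers the weight for
    \<open>a = 0\<close>, \<open>b = 1\<close> and raises it for \<open>a = 1\<close>,
    \<open>b = 0\<close>, while the other letter has weight zero.\<close>
  moreover define l where "l = (if a = 0 then Lx else Ly)"
  ultimately have l: "a = 0 \<and> b = 1 \<and> l = Lx \<or> a = 1 \<and> b = 0 \<and> l = Ly" by presburger
  have uM: "u \<in> carrier M" using u by (simp add: eigenvector_def)
  let ?l = "monomial [l] :: free_elem"
  have lc: "set [l] \<subseteq> {Lx, Ly}" "?l \<in> plane_words" using l by auto
  have "act q M ?l u \<noteq> \<zero>" using kappa_inj_imp_word[OF q(1) inj uM lc(1)] u by auto
  then have "carrier M = {act q M p (act q M ?l u) | p. p \<in> plane_words}"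
    using uM lc by (intro simple_cyclic simple) auto
  then have "u \<in> {act q M p (act q M ?l u) | p. p \<in> plane_words}"
    using uM by (rule subst)
  then obtain p where p: "p \<in> plane_words" "act q M p (act q M ?l u) = u" by force
  \<comment> \<open>Every word of \<open>p l\<close> ends in \<open>l\<close>, and no letter can
    compensate for its weight.\<close>
  have "weight a b (letters w) \<noteq> 0" if "w \<in> Poly_Mapping.keys (p * ?l)" for w
  proof -
    have "w \<in> {w' + Word [l] | w'. w' \<in> Poly_Mapping.keys p}" 
      using that keys_mult[of p ?l] by auto
    then obtain w' where "w = w' + Word [l]" by blast
    then show ?thesis using l by (auto simp: weight_def)
  qed
  moreover have "act q M (p * ?l) u = u" using p lc uM by (simp only: act_mult)
  moreover have "p * ?l \<in> plane_words" using p lc by (intro free_algebra_closed)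
  ultimately show False
    using eigenvector_weights[OF q ab _ \<open>\<mu> \<noteq> 0\<close> u(2)] u(1) by blast
qed

lemma simple_admissible_imp_L:
  assumes q: "q \<noteq> 0" "generic q" and M: "simple_admissible q M"
  shows "\<exists>a b \<Lambda>. (a, b) \<in> P_red \<and> \<Lambda> \<in> Cstar_mod_q q \<and> M \<in> L q a b \<Lambda>"
proof -
  have simple: "simple_module (quantum_plane q) M" and inj: "inj_on (kappa q M) (carrier M)"
    using M by (auto simp: simple_admissible_def admissible_def)
  interpret plane_module q M by (rule simple_module_plane_module) (rule simple)
  obtain m n where "(m, n) \<noteq> (0, 0)" "M \<in> locally_finite_cat q m n"
    using simple_admissible_locally_finite[OF M] .
  moreover have "carrier M \<noteq> {\<zero>\<^bsub>M\<^esub>}" using simple by (simp add: simple_module_def)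
  ultimately obtain a b u \<mu> where u: "coprime a b" "u \<noteq> \<zero>\<^bsub>M\<^esub>" "eigenvector q M (monomial (xy_word a b)) \<mu> u"
    using primitive_eigenvector[OF q(1), of m n] by metis
  have "\<mu> \<noteq> 0"
  proof
    assume "\<mu> = 0"
    then have "act q M (monomial (xy_word a b)) u = \<zero>\<^bsub>M\<^esub>" using u by (simp add: eigenvector_def)
    then show False using kappa_inj_imp_word[OF q(1) inj, of u "xy_word a b"] u by (auto simp: eigenvector_def)
  qed
  moreover have "0 < a \<and> 0 < b"
    using simple_eigenvector_positive[OF q simple inj u(1) \<open>\<mu> \<noteq> 0\<close> u(2,3)] .
  moreover have "\<mu> \<in> q_class q \<mu>" by (auto simp: q_class_def intro!: rangeI image_eqI[of _ _ 0])
  ultimately show ?thesis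
    using u mem_L_iff[OF simple, of a b "q_class q \<mu>"]
    by (intro exI[of _ a] exI[of _ b] exI[of _ "q_class q \<mu>"]) (auto simp: P_red_def Cstar_mod_q_def)
qed

subsection \<open>A weight module\<close>

definition keys_sum :: "('w \<Rightarrow> 'c \<Rightarrow> 'd) \<Rightarrow> ('w \<Rightarrow>\<^sub>0 'c::zero) \<Rightarrow> 'd::comm_monoid_add" where
  "keys_sum \<phi> p = (\<Sum>w\<in>Poly_Mapping.keys p. \<phi> w (Poly_Mapping.lookup p w))"

lemma keys_sum_superset:
  assumes "finite A" "Poly_Mapping.keys p \<subseteq> A" "\<And>w. \<phi> w 0 = 0"
  shows "keys_sum \<phi> p = (\<Sum>w\<in>A. \<phi> w (Poly_Mapping.lookup p w))"
  unfolding keys_sum_def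
  by (rule sum.mono_neutral_left) (use assms in \<open>auto simp: in_keys_iff\<close>)

lemma keys_sum_zero [simp]: "keys_sum \<phi> 0 = 0"
  by (simp add: keys_sum_def)

lemma keys_sum_add:
  fixes \<phi> :: "'w \<Rightarrow> 'c::monoid_add \<Rightarrow> 'd::comm_monoid_add"
  assumes "\<And>w. \<phi> w 0 = 0" "\<And>w c d. \<phi> w (c + d) = \<phi> w c + \<phi> w d"
  shows "keys_sum \<phi> (p + p') = keys_sum \<phi> p + keys_sum \<phi> p'"
proof -
  let ?A = "Poly_Mapping.keys p \<union> Poly_Mapping.keys p'"
  have A: "finite ?A" "Poly_Mapping.keys (p + p') \<subseteq> ?A" "Poly_Mapping.keys p \<subseteq> ?A" "Poly_Mapping.keys p' \<subseteq> ?A"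
    using keys_add[of p p'] by auto
  show ?thesis
    using keys_sum_superset[of ?A "p + p'" \<phi>] keys_sum_superset[of ?A p \<phi>] keys_sum_superset[of ?A p' \<phi>] A assms
    by (simp add: lookup_add sum.distrib)
qed

lemma keys_sum_single [simp]: "\<phi> w 0 = 0 \<Longrightarrow> keys_sum \<phi> (Poly_Mapping.single w c) = \<phi> w c"
  by (simp add: keys_sum_def)

text \<open>\<open>Linv\<close> is sent to the inverse of the operator \<open>x y\<close>; the condition \<open>r^b = q\<close> gives \<open>x y = q y x\<close>.\<close>

locale weight_operators =
  fixes q r \<beta> :: complex and a b :: nat
  assumes r: "r \<noteq> 0" "r ^ b = q" and \<beta>: "\<beta> \<noteq> 0" and pos: "0 < a" "0 < b"
begin

text \<open>On the basis function \<open>e_n\<close> at \<open>n\<close> this reads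
  \<open>x e_n = e_(n-b)\<close> and \<open>y e_n = \<beta> r^n e_(n+a)\<close>. So
  \<open>x y e_n = \<beta> r^n e_(n+a-b)\<close>, which \<open>Linv\<close> inverts.\<close>

definition letter_op :: "letter \<Rightarrow> (int \<Rightarrow> complex) \<Rightarrow> int \<Rightarrow> complex" where
  "letter_op l f k = (case l of
     Lx \<Rightarrow> f (k + int b)
   | Ly \<Rightarrow> \<beta> * r powi (k - int a) * f (k - int a)
   | Linv \<Rightarrow> f (k - int b + int a) / (\<beta> * r powi k))"

text \<open>With \<open>foldr\<close> the last letter acts first, as in a left module.\<close>

definition word_op :: "letter word \<Rightarrow> (int \<Rightarrow> complex) \<Rightarrow> int \<Rightarrow> complex" where
  "word_op w f = foldr letter_op (letters w) f"

definition elem_op :: "free_elem \<Rightarrow> (int \<Rightarrow> complex) \<Rightarrow> int \<Rightarrow> complex" where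
  "elem_op p f k = keys_sum (\<lambda>w c. c * word_op w f k) p"

lemma word_op_simps [simp]:
  "word_op (Word []) f = f" "word_op (Word (l # ls)) f = letter_op l (word_op (Word ls) f)"
  by (simp_all add: word_op_def)

lemma word_op_plus: "word_op (u + w) f = word_op u (word_op w f)"
  by (simp add: word_op_def)

lemma letter_op_add: "letter_op l (\<lambda>k. f k + g k) = (\<lambda>k. letter_op l f k + letter_op l g k)"
  by (rule ext) (simp add: letter_op_def algebra_simps add_divide_distrib split: letter.split)

lemma letter_op_scale: "letter_op l (\<lambda>k. c * f k) = (\<lambda>k. c * letter_op l f k)"
  by (rule ext) (simp add: letter_op_def algebra_simps split: letter.split)

lemma word_op_add: "word_op w (\<lambda>k. f k + g k) = (\<lambda>k. word_op w f k + word_op w g k)"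
proof (cases w)
  case (Word ls)
  show ?thesis unfolding Word by (induction ls) (simp_all add: letter_op_add)
qed

lemma word_op_scale: "word_op w (\<lambda>k. c * f k) = (\<lambda>k. c * word_op w f k)"
proof (cases w)
  case (Word ls)
  show ?thesis unfolding Word by (induction ls) (simp_all add: letter_op_scale)
qed

lemma word_op_null [simp]: "word_op w (\<lambda>_. 0) = (\<lambda>_. 0)"
  using word_op_scale[of w 0 "\<lambda>_. 0"] by simp

lemma elem_op_zero [simp]: "elem_op 0 f k = 0"
  by (simp add: elem_op_def)

lemma elem_op_single [simp]: "elem_op (Poly_Mapping.single w c) f k = c * word_op w f k"
  by (simp add: elem_op_def)

lemma elem_op_one [simp]: "elem_op 1 f = f"
  by (rule ext) (simp flip: const_one)

lemma elem_op_plus: "elem_op (p + p') f k = elem_op p f k + elem_op p' f k"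
  by (simp add: elem_op_def keys_sum_add algebra_simps)

lemma elem_op_add: "elem_op p (\<lambda>k. f k + g k) k = elem_op p f k + elem_op p g k"
  by (induction p rule: free_elem_induct) (simp_all add: elem_op_plus word_op_add algebra_simps)

lemma elem_op_scale: "elem_op p (\<lambda>k. c * f k) k = c * elem_op p f k"
  by (induction p rule: free_elem_induct) (simp_all add: elem_op_plus word_op_scale algebra_simps)

lemma elem_op_null [simp]: "elem_op p (\<lambda>_. 0) k = 0"
  using elem_op_scale[of p 0 "\<lambda>_. 0" k] by simp

lemma elem_op_uminus: "elem_op (- p) f k = - elem_op p f k"
  using elem_op_plus[of p "- p" f k] by (simp add: add_eq_0_iff)

lemma elem_op_minus: "elem_op (p - p') f k = elem_op p f k - elem_op p' f k"
  using elem_op_plus[of "p - p'" p' f k] by simp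

lemma elem_op_mult: "elem_op (p * p') f = elem_op p (elem_op p' f)"
proof -
  have single: "elem_op (Poly_Mapping.single u c * p') f k = c * word_op u (elem_op p' f) k" for u c k
  proof (induction p' arbitrary: k rule: free_elem_induct)
    case zero
    have "elem_op 0 f = (\<lambda>_. 0)" by (rule ext) simp
    then show ?case by simp
  next
    case (single w d)
    have "elem_op (Poly_Mapping.single w d) f = (\<lambda>k. d * word_op w f k)" by (rule ext) simp
    then show ?case by (simp add: mult_single word_op_plus word_op_scale)
  next
    case (add p p')
    have "elem_op (p + p') f = (\<lambda>k. elem_op p f k + elem_op p' f k)" by (rule ext) (rule elem_op_plus)
    then show ?case by (simp add: add distrib_left elem_op_plus word_op_add)
  qed
  show ?thesis
    by (rule ext, induction p rule: free_elem_induct) (simp_all add: single elem_op_plus distrib_right)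
qed

text \<open>At \<open>k\<close> the operators \<open>x y\<close> and \<open>y x\<close> evaluate
  \<open>f\<close> at the same point, with factors \<open>\<beta> r^(k+b-a)\<close> and
  \<open>\<beta> r^(k-a)\<close>, whose quotient is \<open>r^b = q\<close>.\<close>

lemma elem_op_relators:
  "elem_op (plane_relator q) f k = 0"
  "elem_op (monomial [Linv, Lx, Ly] - 1) f k = 0"
  "elem_op (monomial [Lx, Ly, Linv] - 1) f k = 0"
proof -
  have "r powi (k + int b - int a) = q * r powi (k - int a)"
    using r by (simp add: power_int_add power_int_diff flip: r(2))
  then show "elem_op (plane_relator q) f k = 0"
    by (simp add: plane_relator_def elem_op_minus monomial_mult letter_op_def algebra_simps)
  show "elem_op (monomial [Linv, Lx, Ly] - 1) f k = 0" "elem_op (monomial [Lx, Ly, Linv] - 1) f k = 0"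
    using r \<beta> by (simp_all add: elem_op_minus letter_op_def algebra_simps)
qed

text \<open>The elements that act as zero on all functions form a two-sided ideal containing the
  relators. So the localised plane acts.\<close>

lemma elem_op_loc_ideal:
  assumes "p \<in> loc_ideal q" shows "elem_op p f k = 0"
proof -
  let ?A = "free_algebra {Lx, Ly, Linv}"
  interpret A: ring ?A by (rule ring_free_algebra)
  let ?I = "{p \<in> carrier ?A. \<forall>f k. elem_op p f k = 0}"
  have "ideal ?I ?A"
  proof (rule idealI)
    show "subgroup ?I (add_monoid ?A)"
    proof (rule group.subgroupI)
      show "Group.group (add_monoid ?A)" by (rule A.a_group)
      show "?I \<noteq> {}" by (auto intro!: exI[of _ 0])
      fix p assume p: "p \<in> ?I"
      have "\<ominus>\<^bsub>?A\<^esub> p = - p" by (rule A.minus_equality) (use p in auto)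
      then show "inv\<^bsub>add_monoid ?A\<^esub> p \<in> ?I" using p by (auto simp: a_inv_def elem_op_uminus)
    qed (auto simp: elem_op_plus)
  next
    fix p s assume "p \<in> ?I" "s \<in> carrier ?A"
    then show "s \<otimes>\<^bsub>?A\<^esub> p \<in> ?I" "p \<otimes>\<^bsub>?A\<^esub> s \<in> ?I"
      by (auto simp: elem_op_mult) (metis elem_op_null ext)
  qed (rule ring_free_algebra)
  then have "loc_ideal q \<subseteq> ?I"
    unfolding loc_ideal_def
    by (rule A.genideal_minimal) (auto simp: elem_op_relators, auto simp: plane_relator_def)
  then show ?thesis using assms by auto
qed

lemma elem_op_cong_loc: "p - p' \<in> loc_ideal q \<Longrightarrow> elem_op p f = elem_op p' f"
  using elem_op_loc_ideal[of "p - p'" f] by (auto simp: elem_op_minus)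

section \<open>Functions of finite support\<close>

definition finite_support :: "(int \<Rightarrow> complex) set" where
  "finite_support = {f. finite {k. f k \<noteq> 0}}"

lemma finite_support_zero [simp]: "(\<lambda>_. 0) \<in> finite_support"
  by (simp add: finite_support_def)

lemma finite_support_add:
  "f \<in> finite_support \<Longrightarrow> g \<in> finite_support \<Longrightarrow> (\<lambda>k. f k + g k) \<in> finite_support"
  unfolding finite_support_def mem_Collect_eq
  by (rule finite_subset[of _ "{k. f k \<noteq> 0} \<union> {k. g k \<noteq> 0}"]) auto

lemma finite_support_scale: 
  "f \<in> finite_support \<Longrightarrow> (\<lambda>k. c k * f k) \<in> finite_support"
  unfolding finite_support_def mem_Collect_eq
  by (rule finite_subset[of _ "{k. f k \<noteq> 0}"]) auto

lemma finite_support_shift: 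
  assumes "f \<in> finite_support" shows "(\<lambda>k. f (k + n)) \<in> finite_support"
proof -
  have "finite ((\<lambda>k. k + n) -` {k. f k \<noteq> 0})"
    using assms by (intro finite_vimageI) (auto simp: finite_support_def inj_def)
  then show ?thesis by (simp add: finite_support_def vimage_def)
qed

lemma finite_support_letter_op: 
  assumes f: "f \<in> finite_support" shows "letter_op l f \<in> finite_support"
proof (cases l)
  case Lx
  then have "letter_op l f = (\<lambda>k. f (k + int b))" by (auto simp: letter_op_def)
  then show ?thesis using finite_support_shift[OF f] by simp
next
  case Ly
  then have "letter_op l f = (\<lambda>k. \<beta> * r powi (k - int a) * f (k + - int a))" by (auto simp: letter_op_def)
  then show ?thesis 
    using finite_support_scale[OF finite_support_shift[OF f], of "\<lambda>k. \<beta> * r powi (k - int a)" "- int a"] by simp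
next
  case Linv
  then have "letter_op l f = (\<lambda>k. inverse (\<beta> * r powi k) * f (k + (int a - int b)))" 
    by (auto simp: letter_op_def field_simps)
  then show ?thesis using finite_support_scale[OF finite_support_shift[OF f]] by simp
qed

lemma finite_support_word_op: "f \<in> finite_support \<Longrightarrow> word_op w f \<in> finite_support"
proof (cases w)
  case (Word ls)
  assume f: "f \<in> finite_support"
  show ?thesis unfolding Word by (induction ls) (simp_all add: f finite_support_letter_op)
qed

lemma finite_support_elem_op: 
  assumes "f \<in> finite_support" shows "elem_op p f \<in> finite_support"
proof (induction p rule: free_elem_induct)
  case zero
  have "elem_op 0 f = (\<lambda>_. 0)" by (rule ext) simp
  then show ?case by simp
next
  case (single w c)
  have "elem_op (Poly_Mapping.single w c) f = (\<lambda>k. c * word_op w f k)" by (rule ext) simp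
  then show ?case using assms by (simp add: finite_support_scale finite_support_word_op)
next
  case (add p p')
  have "elem_op (p + p') f = (\<lambda>k. elem_op p f k + elem_op p' f k)" by (rule ext) (rule elem_op_plus)
  then show ?case by (simp add: add finite_support_add)
qed

definition basis_fun :: "int \<Rightarrow> int \<Rightarrow> complex" where
  "basis_fun n k = (if k = n then 1 else 0)"

lemma finite_support_basis_fun: "basis_fun n \<in> finite_support"
  by (simp add: finite_support_def basis_fun_def)

text \<open>Basis functions are weight vectors, and no word in \<open>x\<close> and \<open>y\<close>
  kills them, because \<open>r\<close> and \<open>\<beta>\<close> are not zero.\<close>

lemma word_op_basis_fun:
  assumes "set w \<subseteq> {Lx, Ly}"
  shows "\<exists>c. c \<noteq> 0 \<and> word_op (Word w) (basis_fun n) = (\<lambda>k. c * basis_fun (n + weight a b w) k)"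
  using assms
proof (induction w)
  case Nil
  show ?case by (intro exI[of _ 1]) (simp add: weight_def)
next
  case (Cons l w)
  then obtain c where c: "c \<noteq> 0" "word_op (Word w) (basis_fun n) = (\<lambda>k. c * basis_fun (n + weight a b w) k)"
    by auto
  show ?case
  proof (cases "l = Lx")
    case True
    have "word_op (Word (l # w)) (basis_fun n) = (\<lambda>k. c * basis_fun (n + weight a b (l # w)) k)"
      using True by (auto simp: c letter_op_def basis_fun_def weight_def algebra_simps)
    then show ?thesis using c by blast
  next
    case False
    then have l: "l = Ly" using Cons.prems by auto
    have "word_op (Word (l # w)) (basis_fun n) = 
      (\<lambda>k. (\<beta> * r powi (n + weight a b w) * c) * basis_fun (n + weight a b (l # w)) k)"
      by (auto simp: l c letter_op_def basis_fun_def weight_def algebra_simps fun_eq_iff intro!: arg_cong[where f = "\<lambda>z. r powi z"])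
    then show ?thesis using c r \<beta> by (intro exI[of _ "\<beta> * r powi (n + weight a b w) * c"]) simp
  qed
qed

lemma word_op_replicate_Lx: "word_op (Word (replicate i Lx @ w)) f k = word_op (Word w) f (k + int i * int b)"
  by (induction i arbitrary: k) (simp_all add: letter_op_def algebra_simps)

text \<open>The letters \<open>y\<close> contribute the exponents \<open>k - a\<close>,
  \<open>k - 2a\<close>, ..., \<open>k - i a\<close> of \<open>r\<close>.\<close>

lemma word_op_replicate_Ly:
  "word_op (Word (replicate i Ly)) f k 
    = \<beta> ^ i * r powi (int i * k - (\<Sum>j\<le>i. int j * int a)) * f (k - int i * int a)"
proof (induction i arbitrary: k)
  case (Suc i)
  have "int (Suc i) * k - (\<Sum>j\<le>Suc i. int j * int a) 
    = (k - int a) + (int i * (k - int a) - (\<Sum>j\<le>i. int j * int a))"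
    by (simp add: algebra_simps)
  then have "r powi (int (Suc i) * k - (\<Sum>j\<le>Suc i. int j * int a)) 
    = r powi (k - int a) * r powi (int i * (k - int a) - (\<Sum>j\<le>i. int j * int a))"
    by (simp only: power_int_add[OF disjI1[OF r(1)]])
  moreover have "k - int (Suc i) * int a = k - int a - int i * int a" by (simp add: algebra_simps)
  ultimately show ?case 
    by (simp only: replicate_Suc word_op_simps letter_op_def letter.case Suc.IH power_Suc mult_ac)
qed simp

text \<open>The shifts by \<open>a b\<close> and \<open>-a b\<close> cancel, and the factor depends
  on \<open>k\<close> only through \<open>r^(b k) = q^k\<close>. The constant in front becomes
  \<open>\<mu>\<close> later by the choice of \<open>\<beta>\<close>.\<close>

lemma xy_word_op:
  "word_op (Word (xy_word a b)) f k 
    = \<beta> ^ b * r powi (int b * int a * int b - (\<Sum>j\<le>b. int j * int a)) * q powi k * f k"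
proof -
  let ?d = "- (\<Sum>j\<le>b. int j * int a)"
  have "r powi (int b * (k + int a * int b) + ?d) = r powi (int b * int a * int b + ?d) * r powi (int b * k)"
    using r by (simp add: algebra_simps flip: power_int_add)
  also have "r powi (int b * k) = q powi k"
    using r(2) by (simp add: power_int_mult)
  finally show ?thesis by (simp add: word_op_replicate_Lx word_op_replicate_Ly algebra_simps)
qed

end

text \<open>Division by \<open>Q\<close> with remainder shows that the vectors \<open>k^i w\<close>
  with \<open>i\<close> below the degree of \<open>Q\<close> span.\<close>

lemma (in plane_module) annihilated_imp_finite_dimensional:
  assumes k: "k \<in> plane_words" and w: "w \<in> carrier M"
    and "Q \<noteq> 0" "act q M (eval_poly_at k Q) w = \<zero>"
  shows "finite_dimensional q M {act q M (eval_poly_at k P) w | P. True}"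
proof -
  let ?W = "{act q M (eval_poly_at k P) w | P. True}"
  let ?F = "(\<lambda>i. act q M (k ^ i) w) ` {..<Polynomial.degree Q}"
  have "act q M (k ^ i) w \<in> ?W" for i
    using eval_poly_at_monom[of k 1 i] by (auto simp: const_one intro!: exI[of _ "Polynomial.monom 1 i"])
  then have F: "?F \<subseteq> ?W" by blast
  have ev_mult: "eval_poly_at k (A * B) = eval_poly_at k A * eval_poly_at k B" for A B
    by (induction A) (simp_all add: eval_poly_at_add eval_poly_at_smult algebra_simps)
  have "complex_subspace q M ?W"
    unfolding complex_subspace_iff
  proof (intro conjI ballI allI subsetI)
    show "\<zero> \<in> ?W" using w by (auto intro!: exI[of _ 0])
  next
    fix u v assume "u \<in> ?W" "v \<in> ?W"
    then obtain A B where "u = act q M (eval_poly_at k A) w" "v = act q M (eval_poly_at k B) w" by blast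
    then show "u \<oplus> v \<in> ?W" using k w
      by (intro CollectI exI[of _ "A + B"]) (auto simp: eval_poly_at_add act_add_left)
  next
    fix c v assume "v \<in> ?W"
    then obtain A where "v = act q M (eval_poly_at k A) w" by blast
    then show "act q M (const c) v \<in> ?W" using k w
      by (intro CollectI exI[of _ "Polynomial.smult c A"]) (auto simp: eval_poly_at_smult act_mult)
  qed (use k w in auto)
  then have "complex_span q M ?F \<subseteq> ?W" using F by (auto simp: complex_span_def)
  moreover have "?W \<subseteq> complex_span q M ?F"
  proof -
    have "act q M (eval_poly_at k P) w \<in> S" if S: "complex_subspace q M S" "?F \<subseteq> S" for P S
    proof -
      have S': "\<zero> \<in> S" "\<And>u v. u \<in> S \<Longrightarrow> v \<in> S \<Longrightarrow> u \<oplus> v \<in> S" "\<And>c v. v \<in> S \<Longrightarrow> act q M (const c) v \<in> S"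
        using S(1) unfolding complex_subspace_iff by blast+
      have low: "act q M (eval_poly_at k (\<Sum>i\<le>d. Polynomial.monom (c i) i)) w \<in> S" if "d < Polynomial.degree Q" for c d
        using that
      proof (induction d)
        case 0
        then have "act q M (k ^ 0) w \<in> S" using S(2) by (intro subsetD[OF S(2)] imageI) auto
        then show ?case using S'(3) w by (simp add: monom_0)
      next
        case (Suc d)
        have "act q M (k ^ Suc d) w \<in> S" using Suc.prems by (intro subsetD[OF S(2)] imageI) auto
        moreover have "eval_poly_at k (\<Sum>i\<le>Suc d. Polynomial.monom (c i) i) 
          = eval_poly_at k (\<Sum>i\<le>d. Polynomial.monom (c i) i) + const (c (Suc d)) * k ^ Suc d"
          by (simp only: sum.atMost_Suc eval_poly_at_add eval_poly_at_monom)
        moreover have "act q M (eval_poly_at k (\<Sum>i\<le>d. Polynomial.monom (c i) i)) w \<in> S"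
          using Suc by simp
        moreover have "k ^ Suc d \<in> plane_words" using k by (rule free_algebra_power_closed)
        ultimately show ?case using S' k w
          by (simp only: act_add_left act_mult eval_poly_at_closed free_algebra_closed(3,7))
      qed
      let ?R = "P mod Q"
      have Pc: "eval_poly_at k A \<in> plane_words" for A using k by simp
      have "eval_poly_at k P = eval_poly_at k (P div Q) * eval_poly_at k Q + eval_poly_at k ?R"
        by (simp flip: ev_mult eval_poly_at_add)
      then have "act q M (eval_poly_at k P) w = act q M (eval_poly_at k ?R) w"
        using w Pc assms(4) by (simp add: act_add_left act_mult free_algebra_closed(7))
      moreover have "act q M (eval_poly_at k ?R) w \<in> S"
      proof (cases "?R = 0")
        case True
        then show ?thesis using w S' by simp
      next
        case False
        then have "Polynomial.degree ?R < Polynomial.degree Q"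
          using degree_mod_less[OF \<open>Q \<noteq> 0\<close>, of P] by auto
        from low[OF this, of "Polynomial.coeff ?R"] show ?thesis by (simp add: poly_as_sum_of_monoms)
      qed
      ultimately show ?thesis by simp
    qed
    then show ?thesis by (auto simp: complex_span_def)
  qed
  ultimately show ?thesis using F unfolding finite_dimensional_def by (intro exI[of _ ?F]) auto
qed

section \<open>The simple module \<open>W\<close> of finitely supported functions\<close>

locale weight_module = weight_operators +
  fixes \<mu> :: complex and h :: "(int \<Rightarrow> complex) \<Rightarrow> 'v"
  assumes generic: "generic q" and coprime: "coprime a b" and \<mu>: "\<mu> \<noteq> 0"
    and diagonal: "\<And>f k. word_op (Word (xy_word a b)) f k = \<mu> * q powi k * f k"
    and inj_h: "inj_on h finite_support"
begin

lemma q_nonzero: "q \<noteq> 0"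
  using r by auto

definition unh :: "'v \<Rightarrow> int \<Rightarrow> complex" where
  "unh = inv_into finite_support h"

lemma unh_h [simp]: "f \<in> finite_support \<Longrightarrow> unh (h f) = f"
  by (simp add: unh_def inj_h)

lemma h_eq_iff [simp]: "f \<in> finite_support \<Longrightarrow> g \<in> finite_support \<Longrightarrow> h f = h g \<longleftrightarrow> f = g"
  using inj_h by (auto dest: inj_onD)

text \<open>The injection \<open>h\<close> transports the functions into the type \<open>'v\<close>,
  where carriers have to live. A scalar is a coset, so it acts through a chosen representative;
  \<open>elem_op_some_plane\<close> shows that the choice does not matter.\<close>

definition W :: "(free_elem set, 'v) module" where
  "W = \<lparr>carrier = h ` finite_support, monoid.mult = undefined, one = undefined,
     ring.zero = h (\<lambda>_. 0), ring.add = (\<lambda>u v. h (\<lambda>k. unh u k + unh v k)),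
     module.smult = (\<lambda>C v. h (elem_op (SOME p. p \<in> C) (unh v)))\<rparr>"

lemma carrier_W: "carrier W = h ` finite_support"
  by (simp add: W_def)

lemma zero_W: "\<zero>\<^bsub>W\<^esub> = h (\<lambda>_. 0)"
  by (simp add: W_def)

lemma add_W: "\<lbrakk>f \<in> finite_support; g \<in> finite_support\<rbrakk> \<Longrightarrow> h f \<oplus>\<^bsub>W\<^esub> h g = h (\<lambda>k. f k + g k)"
  by (simp add: W_def)

lemma elem_op_some_plane:
  assumes "p \<in> plane_words" shows "elem_op (SOME p'. p' \<in> plane_class q p) f = elem_op p f"
proof -
  have "(SOME p'. p' \<in> plane_class q p) \<in> plane_class q p"
    using self_mem_plane_class[OF assms] by (rule someI)
  then show ?thesis
    using mem_plane_classE(2) assms plane_ideal_subset_loc_ideal by (intro elem_op_cong_loc) blast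
qed

lemma act_W: "\<lbrakk>p \<in> plane_words; f \<in> finite_support\<rbrakk> \<Longrightarrow> act q W p (h f) = h (elem_op p f)"
  by (simp add: W_def act_def elem_op_some_plane)

lemma smult_W: "\<lbrakk>p \<in> plane_words; f \<in> finite_support\<rbrakk> \<Longrightarrow> plane_class q p \<odot>\<^bsub>W\<^esub> h f = h (elem_op p f)"
  using act_W by (simp add: act_def)

lemma left_module_W: "left_module (quantum_plane q) W"
proof (intro left_module.intro left_module_axioms.intro)
  show "ring (quantum_plane q)" by (rule ring_quantum_plane)
  have neg: "\<exists>y\<in>carrier W. y \<oplus>\<^bsub>W\<^esub> x = \<zero>\<^bsub>W\<^esub>" if "x \<in> carrier W" for x
  proof -
    obtain f where f: "f \<in> finite_support" "x = h f" using \<open>x \<in> carrier W\<close> by (auto simp: carrier_W)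
    have "(\<lambda>k. - f k) \<in> finite_support" using finite_support_scale[OF f(1), of "\<lambda>_. -1"] by simp
    then show ?thesis using f by (intro bexI[of _ "h (\<lambda>k. - f k)"]) (auto simp: carrier_W zero_W add_W)
  qed
  show "abelian_group W"
    by (rule abelian_groupI) (use neg in \<open>auto simp: carrier_W zero_W add_W finite_support_add algebra_simps\<close>)
qed (auto simp: carrier_quantum_plane carrier_W smult_W add_W plane_class_add plane_class_mult plane_class_one
    finite_support_elem_op finite_support_add elem_op_plus elem_op_add elem_op_mult free_algebra_closed fun_eq_iff)

sublocale W: plane_module q W
  by (rule plane_module.intro) (rule left_module_W)

lemma diagonal_poly:
  "elem_op (eval_poly_at (monomial (xy_word a b)) P) f = (\<lambda>k. poly P (\<mu> * q powi k) * f k)"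
proof (induction P)
  case 0
  show ?case by (rule ext) simp
next
  case (pCons c P)
  have "word_op (Word []) f = f" by simp
  then show ?case
    by (auto simp: elem_op_plus elem_op_mult pCons diagonal algebra_simps)
qed

text \<open>The polynomial with roots \<open>\<mu> q^k\<close>, for \<open>k\<close> in the support
  of \<open>f\<close>, kills \<open>h f\<close> when evaluated at \<open>x^a y^b\<close>.\<close>

lemma W_locally_finite: "W \<in> locally_finite_cat q a b"
proof -
  let ?K = "monomial (xy_word a b)"
  have "finite_dimensional q W {r \<odot>\<^bsub>W\<^esub> w | r. r \<in> polynomials_in q (plane_monomial q a b)}" 
    if w: "w \<in> carrier W" for w
  proof -
    obtain f where f: "f \<in> finite_support" "w = h f" using w by (auto simp: carrier_W)
    let ?Q = "\<Prod>k\<in>{k. f k \<noteq> 0}. [:- (\<mu> * q powi k), 1:]"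
    have fin: "finite {k. f k \<noteq> 0}" using f by (simp add: finite_support_def)
    have "poly ?Q (\<mu> * q powi k) * f k = 0" for k
      using fin by (auto simp: poly_prod)
    then have "(\<lambda>k. poly ?Q (\<mu> * q powi k) * f k) = (\<lambda>_. 0)" by (rule ext)
    then have "act q W (eval_poly_at ?K ?Q) w = \<zero>\<^bsub>W\<^esub>"
      using f by (simp add: act_W diagonal_poly zero_W)
    moreover have "?Q \<noteq> 0" by (auto simp: prod_zero_iff[OF fin])
    ultimately have "finite_dimensional q W {act q W (eval_poly_at ?K P) w | P. True}"
      using W.annihilated_imp_finite_dimensional[of ?K w ?Q] w by auto
    moreover have "{r \<odot>\<^bsub>W\<^esub> w | r. r \<in> polynomials_in q (plane_monomial q a b)} = {act q W (eval_poly_at ?K P) w | P. True}"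
      by (auto simp: plane_monomial_eq polynomials_in_plane_class act_def)
    ultimately show ?thesis by simp
  qed
  then show ?thesis using left_module_W by (simp add: locally_finite_cat_def)
qed

lemma basis_fun_nonzero: "basis_fun n \<noteq> (\<lambda>_. 0)"
  by (auto simp: basis_fun_def fun_eq_iff)

text \<open>A nonzero submodule contains a basis function, since a polynomial in the diagonal
  operator \<open>x^a y^b\<close> isolates one point of a support. Words in \<open>x\<close> and
  \<open>y\<close> then reach all other basis functions, and these span.\<close>

lemma simple_W: "simple_module (quantum_plane q) W"
  unfolding simple_module_def
proof (intro conjI allI impI)
  show "left_module (quantum_plane q) W" by (rule left_module_W)
  show "carrier W \<noteq> {\<zero>\<^bsub>W\<^esub>}"
  proof
    assume "carrier W = {\<zero>\<^bsub>W\<^esub>}"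
    moreover have "h (basis_fun 0) \<in> carrier W" by (simp add: carrier_W finite_support_basis_fun)
    ultimately have "h (basis_fun 0) = h (\<lambda>_. 0)" by (simp add: zero_W)
    then show False using finite_support_basis_fun[of 0] basis_fun_nonzero[of 0] by simp
  qed
next
  fix H assume "submodule H (quantum_plane q) W"
  then have H: "H \<subseteq> carrier W" "\<zero>\<^bsub>W\<^esub> \<in> H" "\<And>u v. u \<in> H \<Longrightarrow> v \<in> H \<Longrightarrow> u \<oplus>\<^bsub>W\<^esub> v \<in> H"
    "\<And>p v. p \<in> plane_words \<Longrightarrow> v \<in> H \<Longrightarrow> act q W p v \<in> H"
    unfolding W.submodule_iff by blast+
  have scale: "h (\<lambda>k. c * f k) \<in> H" if "f \<in> finite_support" "h f \<in> H" for c f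
  proof -
    have "elem_op (const c) f = (\<lambda>k. c * f k)" by (rule ext) simp
    then show ?thesis using H(4)[of "const c" "h f"] that by (simp add: act_W)
  qed
  have unscale: "h f \<in> H" if "f \<in> finite_support" "h (\<lambda>k. c * f k) \<in> H" "c \<noteq> 0" for c f
    using scale[OF finite_support_scale[OF that(1)] that(2), of "inverse c"] that(3)
    by (simp flip: mult.assoc)
  show "H = {\<zero>\<^bsub>W\<^esub>} \<or> H = carrier W"
  proof (cases "H = {\<zero>\<^bsub>W\<^esub>}")
    case False
    then obtain f where f: "f \<in> finite_support" "h f \<in> H" "h f \<noteq> \<zero>\<^bsub>W\<^esub>"
      using H(1,2) by (force simp: carrier_W)
    then obtain n where n: "f n \<noteq> 0" by (auto simp: zero_W fun_eq_iff)
    have fin: "finite {k. f k \<noteq> 0}" using f by (simp add: finite_support_def)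
    \<comment> \<open>As in Lagrange interpolation, the roots are the eigenvalues at the other
      points of the support; the value at \<open>n\<close> is not zero because \<open>q\<close> is
      generic.\<close>
    let ?A = "{k. f k \<noteq> 0} - {n}"
    let ?Q = "\<Prod>k\<in>?A. [:- (\<mu> * q powi k), 1:]"
    let ?c = "poly ?Q (\<mu> * q powi n) * f n"
    have "(\<Prod>k\<in>?A. \<mu> * q powi n - \<mu> * q powi k) \<noteq> 0"
      using fin by (subst prod_zero_iff) (auto simp: \<mu> dest: generic_powi_inj[OF q_nonzero generic])
    then have c: "?c \<noteq> 0" using n by (simp add: poly_prod)
    have "poly ?Q (\<mu> * q powi k) * f k = ?c * basis_fun n k" for k
      using fin by (auto simp: poly_prod basis_fun_def)
    then have eq: "(\<lambda>k. poly ?Q (\<mu> * q powi k) * f k) = (\<lambda>k. ?c * basis_fun n k)"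
      by (rule ext)
    have "h (\<lambda>k. poly ?Q (\<mu> * q powi k) * f k) \<in> H"
      using H(4)[OF eval_poly_at_closed f(2), of "monomial (xy_word a b)" ?Q] f(1) 
      by (simp add: act_W diagonal_poly)
    then have "h (\<lambda>k. ?c * basis_fun n k) \<in> H"
      unfolding eq .
    then have en: "h (basis_fun n) \<in> H"
      by (rule unscale[OF finite_support_basis_fun _ c])
    have basis: "h (basis_fun m) \<in> H" for m
    proof -
      obtain i j where ij: "int a * int j - int b * int i = m - n"
        using ex_weight_counts[OF pos coprime] by blast
      obtain d where d: "d \<noteq> 0" 
        "word_op (Word (xy_word i j)) (basis_fun n) = (\<lambda>k. d * basis_fun (n + weight a b (xy_word i j)) k)"
        using word_op_basis_fun[of "xy_word i j" n] by auto
      have "elem_op (monomial (xy_word i j)) (basis_fun n) = (\<lambda>k. d * basis_fun m k)"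
        by (rule ext) (simp add: d weight_xy_word ij)
      then have "h (\<lambda>k. d * basis_fun m k) \<in> H"
        using H(4)[of "monomial (xy_word i j)", OF _ en] by (simp add: act_W finite_support_basis_fun)
      then show ?thesis
        by (rule unscale[OF finite_support_basis_fun _ d(1)])
    qed
    have "h g \<in> H" if "finite A" "{k. g k \<noteq> 0} \<subseteq> A" for A g
      using that
    proof (induction A arbitrary: g rule: finite_induct)
      case empty
      then have "g = (\<lambda>_. 0)" by auto
      then show ?case using H(2) by (simp add: zero_W)
    next
      case (insert n A)
      \<comment> \<open>One point of the support is split off: \<open>g\<close> is \<open>?g\<close>
        plus a multiple of the basis function at \<open>n\<close>.\<close>
      let ?g = "\<lambda>k. if k = n then 0 else g k"
      have "h ?g \<in> H" using insert by (intro insert.IH) auto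
      moreover have g: "?g \<in> finite_support" unfolding finite_support_def mem_Collect_eq
        by (rule finite_subset[OF _ insert.hyps(1)]) (use insert.prems in auto)
      moreover have "h (\<lambda>k. g n * basis_fun n k) \<in> H"
        by (intro scale finite_support_basis_fun basis)
      ultimately have "h ?g \<oplus>\<^bsub>W\<^esub> h (\<lambda>k. g n * basis_fun n k) \<in> H"
        by (intro H(3))
      then have "h (\<lambda>k. ?g k + g n * basis_fun n k) \<in> H"
        by (subst (asm) add_W[OF g finite_support_scale[OF finite_support_basis_fun]])
      moreover have "(\<lambda>k. ?g k + g n * basis_fun n k) = g" by (auto simp: basis_fun_def fun_eq_iff)
      ultimately show ?case by simp
    qed
    then have "carrier W \<subseteq> H" by (auto simp: carrier_W finite_support_def)
    then show ?thesis using H(1) by blast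
  qed simp
qed

lemma eigenvector_W: "eigenvector q W (monomial (xy_word a b)) \<mu> (h (basis_fun 0))"
proof -
  have "elem_op (monomial (xy_word a b)) (basis_fun 0) = elem_op (const \<mu>) (basis_fun 0)"
    by (rule ext) (simp add: diagonal basis_fun_def)
  then show ?thesis
    unfolding eigenvector_def by (simp add: act_W finite_support_basis_fun carrier_W)
qed

lemma mem_L_W: "\<mu> \<in> \<Lambda> \<Longrightarrow> W \<in> L q a b \<Lambda>"
  unfolding mem_L_iff[OF simple_W]
  using eigenvector_W basis_fun_nonzero[of 0] finite_support_basis_fun[of 0]
  by (intro bexI[of _ \<mu>] exI[of _ "h (basis_fun 0)"]) (auto simp: zero_W)

text \<open>The localised plane acts on functions on the integers; evaluating this action on pure tensors
  gives a map out of the tensor product which is left inverse to \<open>kappa\<close>.\<close>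

definition tensor_eval :: "(free_elem set \<times> 'v \<Rightarrow>\<^sub>0 int) \<Rightarrow> int \<Rightarrow> complex" where
  "tensor_eval z k = keys_sum (\<lambda>(B, v) n. of_int n * elem_op (SOME p. p \<in> B) (unh v) k) z"

lemma tensor_eval_add: "tensor_eval (z + z') k = tensor_eval z k + tensor_eval z' k"
  unfolding tensor_eval_def by (rule keys_sum_add) (auto simp: algebra_simps)

lemma tensor_eval_zero [simp]: "tensor_eval 0 k = 0"
  by (simp add: tensor_eval_def)

lemma tensor_eval_diff: "tensor_eval (z - z') k = tensor_eval z k - tensor_eval z' k"
  using tensor_eval_add[of "z - z'" z' k] by simp

lemma elem_op_some_loc:
  assumes "p \<in> carrier (free_algebra {Lx, Ly, Linv})" 
  shows "elem_op (SOME p'. p' \<in> loc_class q p) f = elem_op p f"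
proof -
  let ?p = "SOME p'. p' \<in> loc_class q p"
  have "?p \<in> loc_class q p"
    using self_mem_loc_class[OF assms] by (rule someI)
  then have "?p - p \<in> loc_ideal q"
    by (auto simp: loc_class_def a_r_coset_def')
  then show ?thesis by (rule elem_op_cong_loc)
qed

lemma tensor_eval_frag_of:
  assumes "p \<in> carrier (free_algebra {Lx, Ly, Linv})" "f \<in> finite_support"
  shows "tensor_eval (frag_of (loc_class q p, h f)) k = elem_op p f k"
  using assms by (simp add: tensor_eval_def elem_op_some_loc)

text \<open>The operation \<open>elem_op\<close> is additive in both arguments and turns products
  into compositions; these facts match the three kinds of relators.\<close>

lemma tensor_eval_relators:
  assumes "z \<in> tensor_relators (quantum_plane q) (localised_plane q) (loc_map q) W"
  shows "tensor_eval z k = 0"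
  using assms plane_words_subset
  by (auto simp: tensor_relators_def carrier_localised_plane carrier_W carrier_quantum_plane loc_map_plane_class
      loc_class_add loc_class_mult add_W smult_W tensor_eval_diff tensor_eval_frag_of finite_support_add finite_support_elem_op
      elem_op_plus elem_op_add elem_op_mult subset_iff free_algebra_closed)

lemma kappa_inj_W: "inj_on (kappa q W) (carrier W)"
proof (rule inj_onI)
  let ?B = "localised_plane q" and ?T = "tensor_kernel (quantum_plane q) (localised_plane q) (loc_map q) W"
  fix u v assume uv: "u \<in> carrier W" "v \<in> carrier W" "kappa q W u = kappa q W v"
  interpret B: ring ?B by (rule ring_localised_plane)
  obtain f g where fg: "u = h f" "v = h g" "f \<in> finite_support" "g \<in> finite_support" 
    using uv by (auto simp: carrier_W)
  have "frag_of (\<one>\<^bsub>?B\<^esub>, u) - frag_of (\<one>\<^bsub>?B\<^esub>, v) \<in> ?T"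
    using uv(3) unfolding kappa_def
    by (subst (asm) pure_tensor_eq_iff[OF ring_localised_plane loc_map_closed left_module_W]) (use uv in auto)
  moreover have "tensor_eval z k = 0" if "z \<in> ?T" for z k
    using that unfolding tensor_kernel_def
  proof (induction rule: generate.induct)
    \<comment> \<open>An inverse in the free abelian group is a negative, on which the evaluation
      changes sign.\<close>
    case (inv z)
    then have "z \<in> carrier (free_Abelian_group (carrier ?B \<times> carrier W))"
      using tensor_relators_subset[OF ring_localised_plane _ left_module_W, of "loc_map q"] loc_map_closed by blast
    then show ?case using tensor_eval_relators[OF inv] tensor_eval_diff[of 0 z] by simp
  qed (auto simp: tensor_eval_add tensor_eval_relators)
  \<comment> \<open>Evaluating the difference of the two pure tensors gives
    \<open>f - g\<close>.\<close>
  ultimately have "elem_op 1 f k - elem_op 1 g k = 0" for k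
    using fg tensor_eval_frag_of[of 1] by (metis loc_class_one tensor_eval_diff free_algebra_closed(2))
  then have "f = g" by (auto simp: fun_eq_iff)
  then show "u = v" using fg by simp
qed

lemma simple_admissible_W: "simple_admissible q W"
  unfolding simple_admissible_def admissible_def
proof (intro conjI)
  \<comment> \<open>A single summand, \<open>W\<close> itself, serves as the decomposition, with
    \<open>x^a y^b\<close> acting locally finitely.\<close>
  have "carrier W = finite_sum_of W 1 (\<lambda>_. carrier W)"
    unfolding finite_sum_of_def by (auto simp: lessThan_Suc intro!: exI[of _ "\<lambda>_. _"])
  moreover have "submodule (carrier W) (quantum_plane q) W" by (auto simp: W.submodule_iff)
  moreover have "(a, b) \<noteq> (0, 0)" using pos by simp
  moreover have "W\<lparr>carrier := carrier W\<rparr> \<in> locally_finite_cat q a b" using W_locally_finite by simp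
  ultimately show "\<exists>k N. (\<forall>j<k. submodule (N j) (quantum_plane q) W) \<and>
        carrier W = finite_sum_of W k N \<and>
        (\<forall>j<k. \<exists>m n. (m, n) \<noteq> (0, 0) \<and> W\<lparr>carrier := N j\<rparr> \<in> locally_finite_cat q m n)"
    by (intro exI[of _ 1] exI[of _ "\<lambda>_. carrier W"]) blast
qed (rule left_module_W kappa_inj_W simple_W)+

end

section \<open>Choice of the parameters and existence\<close>

lemma complex_root_exists:
  fixes z :: complex
  assumes "0 < n"
  shows "\<exists>w. w ^ n = z"
proof -
  have "rcis (root n (cmod z)) (Arg z / real n) ^ n = rcis (cmod z) (Arg z)"
    using assms by (simp add: DeMoivre2)
  then show ?thesis by (metis rcis_cmod_Arg)
qed

text \<open>A function of finite support is determined by its graph over the support, a finite set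
  of pairs of complex numbers. An infinite set has as many finite subsets as elements, so these
  graphs embed into the complex numbers, and from there into \<open>'v\<close> by
  \<open>f\<close>.\<close>

lemma finite_support_inj:
  assumes "inj (f :: complex \<Rightarrow> 'v)"
  shows "\<exists>h :: (int \<Rightarrow> complex) \<Rightarrow> 'v. inj_on h {f. finite {k. f k \<noteq> 0}}"
proof -
  have inf: "infinite (UNIV :: complex set)" by (rule infinite_UNIV_char_0)
  have "Fpow (UNIV :: (complex \<times> complex) set) \<approx> (UNIV :: (complex \<times> complex) set)"
    using inf by (intro eqpoll_Fpow) (simp add: finite_prod)
  also have "(UNIV :: (complex \<times> complex) set) \<approx> (UNIV :: complex set)"
    unfolding eqpoll_iff_card_of_ordIso using card_of_Times_same_infinite[OF inf] by simp
  finally obtain g :: "(complex \<times> complex) set \<Rightarrow> complex" where g: "inj_on g (Fpow UNIV)"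
    by (auto simp: eqpoll_def bij_betw_def)
  let ?G = "\<lambda>u :: int \<Rightarrow> complex. (\<lambda>k. (of_int k :: complex, u k)) ` {k. u k \<noteq> 0}"
  have "inj_on ?G {u. finite {k. u k \<noteq> 0}}"
  proof (rule inj_onI)
    fix u w :: "int \<Rightarrow> complex" assume eq: "?G u = ?G w"
    have sub: "w k = u k" if "?G u \<subseteq> ?G w" "u k \<noteq> 0" for u w :: "int \<Rightarrow> complex" and k
      using that by (auto simp: image_subset_iff)
    have "u k = w k" for k
      using sub[OF equalityD1[OF eq], of k] sub[OF equalityD2[OF eq], of k] by metis
    then show "u = w" by (rule ext)
  qed
  moreover have "?G ` {u. finite {k. u k \<noteq> 0}} \<subseteq> Fpow UNIV"
    by (auto simp: Fpow_def)
  ultimately have "inj_on (g \<circ> ?G) {u. finite {k. u k \<noteq> 0}}"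
    by (intro comp_inj_on inj_on_subset[OF g])
  then have "inj_on (f \<circ> (g \<circ> ?G)) {u. finite {k. u k \<noteq> 0}}"
    by (rule comp_inj_on[OF _ inj_on_subset[OF assms subset_UNIV]])
  then show ?thesis by blast
qed

lemma ex_simple_admissible_in_L:
  fixes q :: complex
  assumes q: "q \<noteq> 0" "generic q" and universe: "\<exists>f :: complex \<Rightarrow> 'v. inj f"
    and ab: "(a, b) \<in> P_red" and \<Lambda>: "\<Lambda> \<in> Cstar_mod_q q"
  shows "\<exists>M :: (free_elem set, 'v) module. simple_admissible q M \<and> M \<in> L q a b \<Lambda>"
proof -
  have ab': "0 < a" "0 < b" "coprime a b" using ab by (auto simp: P_red_def)
  obtain \<mu> where \<mu>: "\<mu> \<noteq> 0" "\<Lambda> = q_class q \<mu>" using \<Lambda> by (auto simp: Cstar_mod_q_def)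
  have \<mu>\<Lambda>: "\<mu> \<in> \<Lambda>" unfolding \<mu>(2) q_class_def by (rule image_eqI[of _ _ 0]) auto
  obtain h :: "(int \<Rightarrow> complex) \<Rightarrow> 'v" where h: "inj_on h {f. finite {k. f k \<noteq> 0}}"
    using universe finite_support_inj by blast
  \<comment> \<open>A root of order \<open>b\<close> makes \<open>x y = q y x\<close> hold although
    \<open>x\<close> shifts by \<open>b\<close>.\<close>
  obtain r where r: "r ^ b = q" using complex_root_exists[OF ab'(2)] by blast
  have r0: "r \<noteq> 0" using r q ab' by (auto simp: power_0_left)
  let ?c = "r powi (int b * int a * int b - (\<Sum>j\<le>b. int j * int a))"
  \<comment> \<open>By \<open>xy_word_op\<close> the word \<open>x^a y^b\<close> acts at 0 by
    \<open>\<beta>^b\<close> times \<open>?c\<close>, and this product has to be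
    \<open>\<mu>\<close>.\<close>
  obtain \<beta> where \<beta>: "\<beta> ^ b = \<mu> / ?c" using complex_root_exists[OF ab'(2)] by blast
  have \<beta>0: "\<beta> \<noteq> 0" using \<beta> \<mu> r0 ab' by (auto simp: power_0_left)
  have diag: "\<beta> ^ b * ?c = \<mu>" using \<beta> r0 by simp
  interpret weight_operators q r \<beta> a b
    by unfold_locales (use r r0 ab' \<beta>0 in auto)
  interpret weight_module q r \<beta> a b \<mu> h
    by unfold_locales (use q ab' \<mu> h in \<open>auto simp: finite_support_def xy_word_op diag\<close>)
  show ?thesis using simple_admissible_W mem_L_W[OF \<mu>\<Lambda>] by blast
qed

text \<open>The assumption \<open>universe\<close> gives room in \<open>'v\<close> for a copy of
  each module. Then every \<open>L q a b \<Lambda>\<close> contains a simple admissible module and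
  equals its isomorphism class, so both sides are the same set of classes.\<close>

theorem corollary5p1:
  fixes q :: complex
  assumes "q \<noteq> 0" and "generic q"
    and universe: "\<exists>f :: complex \<Rightarrow> 'v. inj f"
  shows "{iso_class (quantum_plane q) M | M :: (free_elem set, 'v) module. simple_admissible q M}
       = {L q a b \<Lambda> | a b \<Lambda>. (a, b) \<in> P_red \<and> \<Lambda> \<in> Cstar_mod_q q}"
proof (intro equalityI subsetI)
  note q = assms(1,2)
  fix C assume "C \<in> {iso_class (quantum_plane q) M | M :: (free_elem set, 'v) module. simple_admissible q M}"
  then obtain M :: "(free_elem set, 'v) module" where M: "simple_admissible q M" "C = iso_class (quantum_plane q) M"
    by blast
  obtain a b \<Lambda> where L: "(a, b) \<in> P_red" "\<Lambda> \<in> Cstar_mod_q q" "M \<in> L q a b \<Lambda>"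
    using simple_admissible_imp_L[OF q M(1)] by blast
  then show "C \<in> {L q a b \<Lambda> | a b \<Lambda>. (a, b) \<in> P_red \<and> \<Lambda> \<in> Cstar_mod_q q}"
    using iso_class_eq_L[OF q L] M(2) by blast
next
  note q = assms(1,2)
  fix C :: "(free_elem set, 'v) module set"
  assume "C \<in> {L q a b \<Lambda> | a b \<Lambda>. (a, b) \<in> P_red \<and> \<Lambda> \<in> Cstar_mod_q q}"
  then obtain a b \<Lambda> where L: "(a, b) \<in> P_red" "\<Lambda> \<in> Cstar_mod_q q" "C = L q a b \<Lambda>"
    by blast
  obtain M :: "(free_elem set, 'v) module" where M: "simple_admissible q M" "M \<in> L q a b \<Lambda>"
    using ex_simple_admissible_in_L[OF q universe L(1,2)] by blast
  then show "C \<in> {iso_class (quantum_plane q) M | M :: (free_elem set, 'v) module. simple_admissible q M}"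
    using iso_class_eq_L[OF q L(1,2) M(2)] L(3) by blast
qed

end
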